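(* Let $d,n\in\mathbb{N}$ and let $f\colon\mathbb{R}^d\to\mathbb{R}$ be a convex function. Define $\operatorname{FP}_f\colon\operatorname{S}(d,n)\to\mathbb{R}$ by $\operatorname{FP}_f(Z):=f(\lambda(ZZ^* ))$. Then $\operatorname{FP}_f$ has no spurious local minimizers, i.e., every local minimizer of $\operatorname{FP}_f$ on $\operatorname{S}(d,n)$ is a global minimizer of $\operatorname{FP}_f$ on $\operatorname{S}(d,n)$.
   Context: Here $d,n\geq1$. $\operatorname{S}(d,n)$ is the set of matrices in $\mathbb{C}^{d\times n}$ all of whose columns have unit Euclidean norm, with the subspace topology from $\mathbb{C}^{d\times n}$. For a self-adjoint matrix $A\in\mathbb{C}^{d\times d}$, $\lambda(A)\in\mathbb{R}^d$ denotes the vector of eigenvalues of $A$ (counted with multiplicity) sorted in monotonically decreasing order. A spurious local minimizer is a local minimizer that is not a global minimizer. *)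

theory Defs
  imports
    "HOL-Analysis.Analysis"
    "HOL-Computational_Algebra.Fundamental_Theorem_Algebra"
begin

text \<open>
  Complex \<open>d \<times> n\<close> matrices are elements of \<^typ>\<open>complex ^ 'n ^ 'd\<close>, where \<open>d\<close> and \<open>n\<close> are the
  cardinalities of the finite, nonempty index types \<open>'d\<close> and \<open>'n\<close>. Their library topology is the
  Euclidean one. The row index type \<open>'d\<close> is linearly ordered wherever a sorted vector
  indexed by it is needed; its order plays the role of the order of \<open>1, \<dots>, d\<close>.
\<close>

definition unit_column_matrices :: "(complex ^ 'n ^ 'd) set" where
  "unit_column_matrices = {Z. \<forall>j. norm (column j Z) = 1}"

definition conj_transpose :: "complex ^ 'n ^ 'm \<Rightarrow> complex ^ 'm ^ 'n" where
  "conj_transpose A = (\<chi> i j. cnj (A $ j $ i))"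

definition char_polynomial :: "complex ^ 'n ^ 'n \<Rightarrow> complex poly" where
  "char_polynomial A = det (\<chi> i j. (if i = j then [:0, 1:] else 0) - [:A $ i $ j:])"

text \<open>
  Used for self-adjoint \<open>A\<close> only: the roots of its characteristic polynomial
  (with multiplicity) are then real, so that \<^const>\<open>Re\<close> merely changes their type.
\<close>

definition real_eigenvalues :: "complex ^ 'n ^ 'n \<Rightarrow> real multiset" where
  "real_eigenvalues A = image_mset Re (proots (char_polynomial A))"

text \<open>
  The characteristic polynomial has degree \<open>CARD('d)\<close>, so the sorted list below has length \<open>CARD('d)\<close>;
  list positions start at \<open>0\<close>, and an index \<open>i\<close> has \<open>card {..<i}\<close> predecessors in \<open>'d\<close>.
\<close>

definition eigenvalue_vector ::
  "complex ^ ('d :: {finite, linorder}) ^ ('d :: {finite, linorder}) \<Rightarrow>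
    real ^ ('d :: {finite, linorder})" where
  "eigenvalue_vector A = (\<chi> i. rev (sorted_list_of_multiset (real_eigenvalues A)) ! card {..<i})"

definition frame_potential ::
  "(real ^ ('d :: {finite, linorder}) \<Rightarrow> real) \<Rightarrow> complex ^ 'n ^ ('d :: {finite, linorder}) \<Rightarrow> real" where
  "frame_potential f Z = f (eigenvalue_vector (Z ** conj_transpose Z))"

definition global_minimizer_on :: "'a set \<Rightarrow> ('a \<Rightarrow> real) \<Rightarrow> 'a \<Rightarrow> bool" where
  "global_minimizer_on S F x \<longleftrightarrow> x \<in> S \<and> (\<forall>y\<in>S. F x \<le> F y)"

definition local_minimizer_on :: "'a :: topological_space set \<Rightarrow> ('a \<Rightarrow> real) \<Rightarrow> 'a \<Rightarrow> bool" where
  "local_minimizer_on S F x \<longleftrightarrow>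
    x \<in> S \<and> (\<exists>U. open U \<and> x \<in> U \<and> (\<forall>y\<in>S \<inter> U. F x \<le> F y))"

end

theory Submission
  imports Defs
begin

text \<open>
  Write \<open>\<lambda>(Z)\<close> for the sorted spectrum of the frame operator \<open>Z Z\<^sup>\<dagger>\<close>. Since \<open>f\<close> may
  treat its arguments differently, \<open>f (\<lambda>(Z))\<close> is in general not a convex function of \<open>Z Z\<^sup>\<dagger>\<close>. Convexity
  is available only on the segment from \<open>\<lambda>(Z)\<close> to \<open>\<lambda>(V)\<close>, for a competitor \<open>V\<close>, and what is needed is
  that this segment can be followed from \<open>Z\<close>: there are \<open>Z\<^sub>s\<close> with unit columns, \<open>Z\<^sub>s \<longlonglongrightarrow> Z\<close> as \<open>s\<close> decreases to
  \<open>0\<close>, and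
  \<open>\<lambda>(Z\<^sub>s) = \<lambda>(Z) + s\<^sup>2 (\<lambda>(V) - \<lambda>(Z)) + o(s\<^sup>2)\<close> (lemma \<open>frame_path_exists\<close>). First-order accuracy is
  enough, because the error can be absorbed into the far end of the segment, where \<open>f\<close> is continuous.

  To construct \<open>Z\<^sub>s\<close>, start from a singular value decomposition of \<open>Z\<close> and move the singular values. This
  gives the desired spectrum exactly, but the Gram matrix \<open>G = Z\<^sup>\<dagger> Z\<close> becomes \<open>G + s\<^sup>2 H\<close>, whose diagonal
  is no longer \<open>1\<close>. The diagonal is repaired by a factor \<open>1 + s B + s\<^sup>2 P\<close> on the right that is unitary up
  to \<open>O(s\<^sup>3)\<close>; the remaining error \<open>O(s\<^sup>3)\<close> in the column norms is removed by normalizing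
  (lemma \<open>frame_path\<close>), and Weyl's inequality controls what this does to the spectrum.

  The heart is the choice of \<open>B\<close> and \<open>P\<close> (lemma \<open>diagonal_correction\<close>). Infinitesimal conjugation changes
  the diagonal of \<open>G\<close> in all directions whose sum over each connected component of the graph of non-zero
  entries of \<open>G\<close> vanishes. Moving diagonal mass between components is a second-order effect: rotating an
  eigenvector of eigenvalue \<open>\<pi>\<close> on one component against one of eigenvalue \<open>\<theta>\<close> on another transfers an
  amount proportional to \<open>\<pi> - \<theta>\<close>. As the diagonal of \<open>G\<close> is \<open>1\<close>, every component has an eigenvalue \<open>\<ge> 1\<close>
  and one \<open>\<le> 1\<close>, strictly so for a component with two non-orthogonal columns. Such a component can
  therefore exchange mass with all others in both directions. If there is none, the columns of \<open>Z\<close> are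
  orthonormal, and choosing the Fourier basis as singular vectors keeps the diagonal of \<open>H\<close> at \<open>0\<close>
  (lemma \<open>isometry_flat_decomposition\<close>).
\<close>

section \<open>Matrix algebra\<close>

notation conj_transpose ("_\<^sup>\<dagger>" [1000] 999)

lemma bounded_bilinear_matrix_mult:
  "bounded_bilinear ((**) :: complex^'n^'m \<Rightarrow> complex^'p^'n \<Rightarrow> complex^'p^'m)"
proof -
  have "bilinear ((**) :: complex^'n^'m \<Rightarrow> complex^'p^'n \<Rightarrow> complex^'p^'m)"
    unfolding bilinear_def
    by (auto intro!: linearI simp: vec_eq_iff matrix_matrix_mult_def algebra_simps sum.distrib
        scaleR_sum_right)
  then show ?thesis
    by (simp add: bilinear_conv_bounded_bilinear)
qed

lemmas matrix_mult_bilinear =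
  bounded_bilinear.add_left[OF bounded_bilinear_matrix_mult]
  bounded_bilinear.add_right[OF bounded_bilinear_matrix_mult]
  bounded_bilinear.diff_left[OF bounded_bilinear_matrix_mult]
  bounded_bilinear.diff_right[OF bounded_bilinear_matrix_mult]
  bounded_bilinear.minus_left[OF bounded_bilinear_matrix_mult]
  bounded_bilinear.minus_right[OF bounded_bilinear_matrix_mult]
  bounded_bilinear.scaleR_left[OF bounded_bilinear_matrix_mult]
  bounded_bilinear.scaleR_right[OF bounded_bilinear_matrix_mult]

lemmas tendsto_matrix_mult [tendsto_intros] =
  bounded_bilinear.tendsto[OF bounded_bilinear_matrix_mult]

lemma conj_transpose_nth [simp]: "A\<^sup>\<dagger> $ i $ j = cnj (A $ j $ i)"
  by (simp add: conj_transpose_def)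

lemma conj_transpose_mult: "(A ** B)\<^sup>\<dagger> = B\<^sup>\<dagger> ** A\<^sup>\<dagger>"
  by (simp add: vec_eq_iff matrix_matrix_mult_def mult.commute)

lemma conj_transpose_conj_transpose [simp]: "(A\<^sup>\<dagger>)\<^sup>\<dagger> = A"
  by (simp add: vec_eq_iff)

lemma conj_transpose_mat_1 [simp]: "(mat 1)\<^sup>\<dagger> = mat 1"
  by (simp add: vec_eq_iff mat_def)

lemma conj_transpose_linear:
  "(A + B)\<^sup>\<dagger> = A\<^sup>\<dagger> + B\<^sup>\<dagger>" "(A - B)\<^sup>\<dagger> = A\<^sup>\<dagger> - B\<^sup>\<dagger>" "(- A)\<^sup>\<dagger> = - A\<^sup>\<dagger>" "(r *\<^sub>R A)\<^sup>\<dagger> = r *\<^sub>R A\<^sup>\<dagger>"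
  by (simp_all add: vec_eq_iff)

lemma tendsto_conj_transpose [tendsto_intros]:
  fixes A :: "complex^'n^'m"
  assumes "(f \<longlongrightarrow> A) F"
  shows "((\<lambda>x. (f x)\<^sup>\<dagger>) \<longlongrightarrow> A\<^sup>\<dagger>) F"
proof -
  have "linear (conj_transpose :: complex^'n^'m \<Rightarrow> _)"
    by (rule linearI) (simp_all add: conj_transpose_linear)
  then show ?thesis
    using assms by (simp add: linear_conv_bounded_linear bounded_linear.tendsto)
qed

definition cinner :: "complex^'n \<Rightarrow> complex^'n \<Rightarrow> complex" where
  "cinner x y = (\<Sum>i\<in>UNIV. cnj (x $ i) * y $ i)"

lemma Re_cinner: "Re (cinner x y) = x \<bullet> y"
  by (simp add: cinner_def inner_vec_def inner_complex_def)

lemma cnj_cinner: "cnj (cinner x y) = cinner y x"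
  by (simp add: cinner_def mult.commute)

lemma cinner_self: "cinner x x = of_real ((norm x)\<^sup>2)"
proof -
  have "Im (cinner x x) = 0"
    by (simp add: cinner_def)
  moreover have "Re (cinner x x) = (norm x)\<^sup>2"
    by (simp add: Re_cinner power2_norm_eq_inner)
  ultimately show ?thesis
    by (simp add: complex_eq_iff)
qed

lemma mult_cnj_eq_cmod_square: "z * cnj z = of_real ((cmod z)\<^sup>2)"
  by (simp only: complex_norm_square)

lemma norm_square_eq_sum: "(norm x)\<^sup>2 = (\<Sum>i\<in>UNIV. (cmod (x $ i))\<^sup>2)" for x :: "complex^'n"
  by (simp add: norm_vec_def L2_set_def sum_nonneg)

lemma cinner_adjoint: "cinner x (A *v y) = cinner (A\<^sup>\<dagger> *v x) y"
  unfolding cinner_def matrix_vector_mult_def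
  by (simp add: sum_distrib_left sum_distrib_right mult_ac)
     (subst sum.swap, simp add: mult_ac)

lemma inner_adjoint: "x \<bullet> (A *v y) = (A\<^sup>\<dagger> *v x) \<bullet> (y :: complex^'n)"
  by (metis Re_cinner cinner_adjoint)

lemma linear_matrix_vector: "linear ((*v) (A :: complex^'n^'m))"
  by (rule linearI) (simp_all add: vec_eq_iff matrix_vector_mult_def algebra_simps sum.distrib
      scaleR_sum_right)

lemma gram_nth: "(A\<^sup>\<dagger> ** A) $ i $ j = cinner (column i A) (column j A)"
  by (simp add: matrix_matrix_mult_def cinner_def column_def)

definition real_diagonal :: "real^'n \<Rightarrow> complex^'n^'n" where
  "real_diagonal x = (\<chi> i j. if i = j then of_real (x $ i) else 0)"

lemma mult_real_diagonal_nth: "(A ** real_diagonal x) $ i $ j = A $ i $ j * of_real (x $ j)"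
  by (simp add: matrix_matrix_mult_def real_diagonal_def if_distrib if_distribR cong: if_cong)

lemma real_diagonal_mult_nth: "(real_diagonal x ** A) $ i $ j = of_real (x $ i) * A $ i $ j"
  by (simp add: matrix_matrix_mult_def real_diagonal_def if_distrib if_distribR cong: if_cong)

lemma real_diagonal_mult: "real_diagonal x ** real_diagonal y = real_diagonal (\<chi> i. x $ i * y $ i)"
  by (simp add: vec_eq_iff mult_real_diagonal_nth) (simp add: real_diagonal_def)

lemma conj_transpose_real_diagonal [simp]: "(real_diagonal x)\<^sup>\<dagger> = real_diagonal x"
  by (simp add: vec_eq_iff real_diagonal_def)

lemma real_diagonal_linear:
  "real_diagonal (x + y) = real_diagonal x + real_diagonal y"
  "real_diagonal (x - y) = real_diagonal x - real_diagonal y"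
  "real_diagonal (r *\<^sub>R x) = r *\<^sub>R real_diagonal x"
  by (simp_all add: vec_eq_iff real_diagonal_def) (simp add: scaleR_conv_of_real)

lemma tendsto_real_diagonal [tendsto_intros]:
  fixes x :: "real^'n"
  assumes "(f \<longlongrightarrow> x) F"
  shows "((\<lambda>t. real_diagonal (f t)) \<longlongrightarrow> real_diagonal x) F"
proof -
  have "linear (real_diagonal :: real^'n \<Rightarrow> _)"
    by (rule linearI) (simp_all add: real_diagonal_linear)
  then show ?thesis
    using assms by (simp add: linear_conv_bounded_linear bounded_linear.tendsto)
qed

section \<open>Orthonormal families\<close>

definition orthonormal_on :: "'k set \<Rightarrow> ('k \<Rightarrow> complex^'n) \<Rightarrow> bool" where
  "orthonormal_on J a \<longleftrightarrow> (\<forall>j\<in>J. \<forall>k\<in>J. cinner (a j) (a k) = (if j = k then 1 else 0))"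

lemma orthonormal_on_norm:
  assumes "orthonormal_on J a" "j \<in> J" shows "norm (a j) = 1"
proof -
  have "complex_of_real ((norm (a j))\<^sup>2) = 1"
    using assms unfolding cinner_self[symmetric] by (simp add: orthonormal_on_def)
  then have "(norm (a j))\<^sup>2 = 1"
    using of_real_eq_1_iff by blast
  then show ?thesis
    by (simp add: power2_eq_1_iff) (metis norm_ge_zero not_one_le_zero neg_0_le_iff_le)
qed

text \<open>
  Complex orthogonality to \<open>a j\<close> is real orthogonality to \<open>a j\<close> and \<open>\<i> a j\<close>, so a real dimension
  count suffices. Everything below that would otherwise need complex dimensions (extension of
  orthonormal families, the spectral theorem, Weyl's inequality) goes through this lemma.
\<close>

lemma orthogonal_unit_vector_exists:
  fixes a :: "'k \<Rightarrow> complex^'n"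
  assumes "finite J" "card J < CARD('n)"
  shows "\<exists>x. norm x = 1 \<and> (\<forall>j\<in>J. cinner (a j) x = 0)"
proof -
  define b where "b = (\<lambda>j. \<chi> i. \<i> * a j $ i)"
  define S where "S = a ` J \<union> b ` J"
  have "card S \<le> card (a ` J) + card (b ` J)"
    unfolding S_def by (rule card_Un_le)
  also have "\<dots> \<le> card J + card J"
    by (intro add_mono card_image_le assms)
  also have "\<dots> < DIM(complex^'n)"
    using assms by simp
  finally have "card S < DIM(complex^'n)" .
  moreover have "dim S \<le> card S"
    using assms by (intro dim_le_card) (auto simp: S_def span_superset)
  ultimately have dim: "dim S < DIM(complex^'n)"
    by simp
  obtain x where x: "x \<noteq> 0" "\<And>y. y \<in> span S \<Longrightarrow> orthogonal x y"
    by (rule orthogonal_to_subspace_exists[OF dim]) blast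
  have "cinner (a j) x = 0" if "j \<in> J" for j
  proof -
    have 1: "Re (cinner (a j) x) = 0"
      using x(2)[of "a j"] that
      by (simp add: Re_cinner orthogonal_def inner_commute S_def span_base)
    have "Re (cinner (b j) x) = 0"
      using x(2)[of "b j"] that
      by (simp add: Re_cinner orthogonal_def inner_commute S_def span_base)
    moreover have "cinner (b j) x = - \<i> * cinner (a j) x"
      by (simp add: cinner_def b_def sum_distrib_left mult_ac sum_negf)
    ultimately show ?thesis
      using 1 by (simp add: complex_eq_iff)
  qed
  moreover have "cinner y (r *\<^sub>R x) = r *\<^sub>R cinner y x" for y r
    by (simp add: cinner_def scaleR_sum_right)
  ultimately have "norm (x /\<^sub>R norm x) = 1 \<and> (\<forall>j\<in>J. cinner (a j) (x /\<^sub>R norm x) = 0)"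
    using x(1) by simp
  then show ?thesis by blast
qed

lemma orthonormal_on_extend:
  fixes a :: "'k \<Rightarrow> complex^'n"
  assumes "orthonormal_on J a" "J \<subseteq> K" "finite K" "card K \<le> CARD('n)"
  shows "\<exists>b. orthonormal_on K b \<and> (\<forall>j\<in>J. b j = a j)"
proof -
  have "finite L \<Longrightarrow> L \<subseteq> K - J \<Longrightarrow> \<exists>b. orthonormal_on (J \<union> L) b \<and> (\<forall>j\<in>J. b j = a j)" for L
  proof (induction L rule: finite_induct)
    case empty
    then show ?case using assms(1) by auto
  next
    case (insert k L)
    then obtain b where b: "orthonormal_on (J \<union> L) b" "\<forall>j\<in>J. b j = a j"
      by auto
    have k: "k \<notin> J \<union> L" "insert k (J \<union> L) \<subseteq> K"
      using insert.hyps insert.prems assms(2) by auto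
    have "finite (J \<union> L)"
      using assms(2,3) insert.hyps(1) finite_subset by auto
    moreover from this have "card (J \<union> L) < CARD('n)"
      using k assms(3,4) card_mono[OF assms(3) k(2)] by auto
    ultimately obtain x where x: "norm x = 1" "\<forall>j\<in>J \<union> L. cinner (b j) x = 0"
      using orthogonal_unit_vector_exists by metis
    have x': "\<forall>j\<in>J \<union> L. cinner x (b j) = 0"
      using x(2) by (metis cnj_cinner complex_cnj_zero)
    have "orthonormal_on (J \<union> insert k L) (b(k := x))"
      using b(1) x(2) x' k(1) cinner_self[of x] x(1) by (auto simp: orthonormal_on_def)
    then show ?case
      using b(2) k(1) by (metis Un_iff fun_upd_other)
  qed
  from this[of "K - J"] show ?thesis
    using assms(2,3) by (simp add: Un_absorb1)
qed

text \<open>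
  Bessel's inequality for a standard basis vector \<open>e\<^sub>i\<close> says that the \<open>i\<close>-th coordinates of the
  family have squares summing to at most \<open>1\<close>; summing over \<open>i\<close> counts the family.
\<close>

lemma orthonormal_on_card_le:
  fixes a :: "'k \<Rightarrow> complex^'n"
  assumes "finite J" "orthonormal_on J a"
  shows "card J \<le> CARD('n)"
proof -
  have bessel: "(\<Sum>j\<in>J. (cmod (a j $ i))\<^sup>2) \<le> 1" for i
  proof -
    define s where "s = (\<Sum>j\<in>J. (cmod (a j $ i))\<^sup>2)"
    \<comment> \<open>the orthogonal projection of \<open>e\<^sub>i\<close> to the span of the family; both its
       squared norm and its \<open>i\<close>-th coordinate are \<open>s\<close>\<close>
    define y where "y = (\<Sum>j\<in>J. cnj (a j $ i) *s a j)"
    have yi: "y $ i = of_real s"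
      by (simp add: y_def s_def mult_cnj_eq_cmod_square mult.commute[of "cnj z" z for z])
    have "cinner y y = (\<Sum>l\<in>UNIV. (\<Sum>j\<in>J. a j $ i * cnj (a j $ l)) * (\<Sum>k\<in>J. cnj (a k $ i) * a k $ l))"
      by (simp add: cinner_def y_def)
    also have "\<dots> = (\<Sum>l\<in>UNIV. \<Sum>j\<in>J. \<Sum>k\<in>J. (a j $ i * cnj (a j $ l)) * (cnj (a k $ i) * a k $ l))"
      by (simp only: sum_product)
    also have "\<dots> = (\<Sum>j\<in>J. \<Sum>l\<in>UNIV. \<Sum>k\<in>J. (a j $ i * cnj (a j $ l)) * (cnj (a k $ i) * a k $ l))"
      by (rule sum.swap)
    also have "\<dots> = (\<Sum>j\<in>J. \<Sum>k\<in>J. \<Sum>l\<in>UNIV. (a j $ i * cnj (a j $ l)) * (cnj (a k $ i) * a k $ l))"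
      by (intro sum.cong refl, rule sum.swap)
    also have "\<dots> = (\<Sum>j\<in>J. \<Sum>k\<in>J. a j $ i * cnj (a k $ i) * cinner (a j) (a k))"
      by (intro sum.cong refl) (simp add: cinner_def sum_distrib_left mult_ac)
    also have "\<dots> = (\<Sum>j\<in>J. \<Sum>k\<in>J. if k = j then a j $ i * cnj (a k $ i) else 0)"
      using assms(2) by (intro sum.cong refl) (auto simp: orthonormal_on_def)
    also have "\<dots> = of_real s"
      using assms(1) by (simp add: s_def mult_cnj_eq_cmod_square)
    finally have "complex_of_real ((norm y)\<^sup>2) = of_real s"
      by (simp only: cinner_self)
    then have ny: "(norm y)\<^sup>2 = s"
      using of_real_eq_iff by blast
    have s0: "0 \<le> s" by (simp add: s_def sum_nonneg)
    have "s \<le> norm y"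
      using Finite_Cartesian_Product.norm_nth_le[of y i] s0 by (simp add: yi)
    then have "s\<^sup>2 \<le> s"
      using power_mono[of s "norm y" 2] s0 ny by simp
    then have "s \<le> 1"
      using s0 mult_right_le_imp_le[of s s 1] by (cases "s = 0") (auto simp: power2_eq_square)
    then show ?thesis by (simp add: s_def)
  qed
  have "real (card J) = (\<Sum>j\<in>J. (norm (a j))\<^sup>2)"
    using orthonormal_on_norm[OF assms(2)] by simp
  also have "\<dots> = (\<Sum>i\<in>UNIV. \<Sum>j\<in>J. (cmod (a j $ i))\<^sup>2)"
    by (simp add: norm_square_eq_sum) (rule sum.swap)
  also have "\<dots> \<le> (\<Sum>i\<in>(UNIV::'n set). 1)"
    by (intro sum_mono bessel)
  finally show ?thesis by simp
qed

section \<open>The spectral theorem\<close>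

text \<open>
  A maximizer of the Rayleigh quotient on the unit sphere of an invariant subspace is an eigenvector.
  Besides the spectral theorem, this provides eigenvectors of a Gram matrix that are supported on
  one component, together with the bound that compares their eigenvalues with the diagonal.
\<close>

lemma rayleigh_maximum:
  fixes T :: "'a::euclidean_space \<Rightarrow> 'a"
  assumes "linear T" and sym: "\<And>x y. x \<in> V \<Longrightarrow> y \<in> V \<Longrightarrow> x \<bullet> T y = T x \<bullet> y"
    and V: "subspace V" "\<And>x. x \<in> V \<Longrightarrow> T x \<in> V" and "z \<in> V" "z \<noteq> 0"
  obtains x l where "x \<in> V" "norm x = 1" "T x = l *\<^sub>R x" "\<And>y. y \<in> V \<Longrightarrow> y \<bullet> T y \<le> l * (y \<bullet> y)"
proof -
  interpret T: linear T by fact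
  let ?K = "V \<inter> sphere 0 1"
  have "compact ?K"
    by (simp add: V(1) closed_subspace closed_Int_compact)
  moreover have "z /\<^sub>R norm z \<in> ?K"
    using assms(5,6) V(1) by (simp add: subspace_scale)
  moreover have "continuous_on ?K (\<lambda>x. x \<bullet> T x)"
    by (intro continuous_intros linear_continuous_on) (simp add: assms(1) linear_conv_bounded_linear[symmetric])
  ultimately obtain x where x: "x \<in> ?K" and xmax: "\<And>y. y \<in> ?K \<Longrightarrow> y \<bullet> T y \<le> x \<bullet> T x"
    using continuous_attains_sup[of ?K "\<lambda>x. x \<bullet> T x"] by blast
  define l where "l = x \<bullet> T x"
  have xx: "x \<bullet> x = 1"
    using x by (simp add: dot_square_norm)
  have le: "y \<bullet> T y \<le> l * (y \<bullet> y)" if "y \<in> V" for y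
  proof (cases "y = 0")
    case False
    have "(y /\<^sub>R norm y) \<bullet> T (y /\<^sub>R norm y) \<le> l"
      unfolding l_def using that V(1) False by (intro xmax) (simp add: subspace_scale)
    then have "(y \<bullet> T y) / (norm y)\<^sup>2 \<le> l"
      by (simp add: T.scaleR power2_eq_square divide_inverse mult_ac)
    then show ?thesis
      using False by (simp add: divide_le_eq dot_square_norm mult.commute)
  qed (use T.zero in simp)
  \<comment> \<open>the positive semidefinite form of \<open>l - T\<close> vanishes at \<open>x\<close>; varying \<open>x\<close> in the direction \<open>w\<close>
    shows that its kernel contains \<open>x\<close>\<close>
  define w where "w = l *\<^sub>R x - T x"
  have wV: "w \<in> V"
    using x V by (simp add: w_def subspace_diff subspace_scale)
  define c where "c = l * (w \<bullet> w) - w \<bullet> T w"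
  have quad: "2 * e * (w \<bullet> w) \<le> e\<^sup>2 * c" for e
  proof -
    have "x - e *\<^sub>R w \<in> V"
      using x wV V(1) by (simp add: subspace_diff subspace_scale)
    from le[OF this] have "0 \<le> l * ((x - e *\<^sub>R w) \<bullet> (x - e *\<^sub>R w)) - (x - e *\<^sub>R w) \<bullet> T (x - e *\<^sub>R w)"
      by simp
    also have "\<dots> = l * (x \<bullet> x) - x \<bullet> T x - e * (w \<bullet> (l *\<^sub>R x - T x) + (l *\<^sub>R x \<bullet> w - x \<bullet> T w)) + e\<^sup>2 * c"
      by (simp add: c_def T.diff T.scaleR inner_diff power2_eq_square algebra_simps inner_commute)
    also have "x \<bullet> T w = T x \<bullet> w"
      using x wV by (intro sym) auto
    also have "l *\<^sub>R x \<bullet> w - T x \<bullet> w = w \<bullet> w"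
      by (simp add: w_def inner_diff algebra_simps)
    also have "w \<bullet> (l *\<^sub>R x - T x) = w \<bullet> w"
      by (simp add: w_def)
    finally show ?thesis
      by (simp add: l_def xx)
  qed
  have "w \<bullet> w = 0"
  proof (rule ccontr)
    assume "w \<bullet> w \<noteq> 0"
    then have ww: "0 < w \<bullet> w" by (metis inner_gt_zero_iff inner_zero_left)
    show False
    proof (cases "c \<le> 0")
      case True
      then show False using quad[of 1] ww by simp
    next
      case False
      then show False using quad[of "(w \<bullet> w) / c"] mult_pos_pos[OF ww ww]
        by (simp add: power2_eq_square field_simps)
    qed
  qed
  then have "T x = l *\<^sub>R x"
    by (simp add: w_def)
  with x le show thesis
    by (intro that[of x l]) auto
qed

text \<open>
  The orthogonal complement of finitely many eigenvectors is invariant, so any orthonormal family of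
  eigenvectors that is too small can be extended by \<open>rayleigh_maximum\<close>.
\<close>

lemma self_adjoint_eigenbasis:
  fixes A :: "complex^'n^'n"
  assumes "A\<^sup>\<dagger> = A"
  shows "\<exists>u l. orthonormal_on (UNIV :: 'n set) u \<and> (\<forall>j. A *v u j = (l j :: real) *\<^sub>R u j)"
proof -
  have "finite J \<Longrightarrow> \<exists>u l. orthonormal_on J u \<and> (\<forall>j\<in>J. A *v u j = (l j :: real) *\<^sub>R u j)" for J :: "'n set"
  proof (induction J rule: finite_induct)
    case empty
    then show ?case by (simp add: orthonormal_on_def)
  next
    case (insert k J)
    then obtain u and l :: "'n \<Rightarrow> real"
      where u: "orthonormal_on J u" "\<forall>j\<in>J. A *v u j = l j *\<^sub>R u j" by auto
    have "card J < CARD('n)"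
      using insert.hyps by (intro psubset_card_mono) auto
    then obtain z where z: "norm z = 1" "\<forall>j\<in>J. cinner (u j) z = 0"
      using orthogonal_unit_vector_exists insert.hyps by metis
    define V where "V = {x. \<forall>j\<in>J. cinner (u j) x = 0}"
    have V: "subspace V"
      by (auto simp: V_def subspace_def cinner_def distrib_left sum.distrib simp flip: scaleR_sum_right)
    have inv: "A *v x \<in> V" if "x \<in> V" for x
    proof -
      have "cinner (u j) (A *v x) = of_real (l j) * cinner (u j) x" if "j \<in> J" for j
        using u(2) that assms
        by (simp add: cinner_adjoint)
           (simp add: cinner_def scaleR_sum_right flip: scaleR_conv_of_real)
      then show ?thesis using that by (simp add: V_def)
    qed
    obtain x m where x: "x \<in> V" "norm x = 1" "A *v x = m *\<^sub>R x"
    proof (rule rayleigh_maximum[OF linear_matrix_vector[of A] _ V inv])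
      show "x \<bullet> (A *v y) = (A *v x) \<bullet> y" for x y
        by (simp add: inner_adjoint assms)
      show "z \<in> V" "z \<noteq> 0"
        using z by (auto simp: V_def)
    qed
    have x': "\<forall>j\<in>J. cinner (u j) x = 0" "\<forall>j\<in>J. cinner x (u j) = 0"
      using x(1) unfolding V_def by (auto, metis cnj_cinner complex_cnj_zero)
    have "orthonormal_on (insert k J) (u(k := x))"
      using u(1) x' insert.hyps(2) cinner_self[of x] x(2) by (auto simp: orthonormal_on_def)
    moreover have "\<forall>j\<in>insert k J. A *v (u(k := x)) j = (l(k := m)) j *\<^sub>R (u(k := x)) j"
      using u(2) x(3) by auto
    ultimately show ?case by blast
  qed
  from this[of UNIV] show ?thesis by auto
qed

definition matrix_of_columns :: "('k \<Rightarrow> complex^'n) \<Rightarrow> complex^'k^'n" where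
  "matrix_of_columns a = (\<chi> i j. a j $ i)"

lemma column_matrix_of_columns [simp]: "column j (matrix_of_columns a) = a j"
  by (simp add: column_def matrix_of_columns_def vec_eq_iff)

lemma orthonormal_on_UNIV_imp_unitary:
  assumes "orthonormal_on UNIV (u :: 'n \<Rightarrow> complex^'n)"
  shows "(matrix_of_columns u)\<^sup>\<dagger> ** matrix_of_columns u = mat 1"
  using assms by (simp add: vec_eq_iff gram_nth orthonormal_on_def mat_def)

lemma unitary_right_inverse:
  fixes U :: "complex^'n^'n"
  shows "U\<^sup>\<dagger> ** U = mat 1 \<Longrightarrow> U ** U\<^sup>\<dagger> = mat 1"
  using matrix_left_right_inverse by blast

lemma self_adjoint_diagonalization:
  fixes A :: "complex^'n^'n"
  assumes "A\<^sup>\<dagger> = A"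
  obtains U :: "complex^'n^'n" and l where "U\<^sup>\<dagger> ** U = mat 1" "A = U ** real_diagonal l ** U\<^sup>\<dagger>"
proof -
  obtain u l where u: "orthonormal_on (UNIV :: 'n set) u" "\<forall>j. A *v u j = (l j :: real) *\<^sub>R u j"
    using self_adjoint_eigenbasis[OF assms] by auto
  define U where "U = matrix_of_columns u"
  have U: "U\<^sup>\<dagger> ** U = mat 1"
    using orthonormal_on_UNIV_imp_unitary[OF u(1)] by (simp add: U_def)
  have "(A ** U) $ i $ j = (U ** real_diagonal (vec_lambda l)) $ i $ j" for i j
  proof -
    have "(A ** U) $ i $ j = (A *v u j) $ i"
      by (simp add: matrix_matrix_mult_def matrix_vector_mult_def U_def matrix_of_columns_def)
    also have "\<dots> = (U ** real_diagonal (vec_lambda l)) $ i $ j"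
      using u(2) by (simp add: mult_real_diagonal_nth) (simp add: U_def matrix_of_columns_def scaleR_conv_of_real)
    finally show ?thesis .
  qed
  then have AU: "A ** U = U ** real_diagonal (vec_lambda l)"
    by (simp add: vec_eq_iff)
  have "A = A ** (U ** U\<^sup>\<dagger>)"
    using unitary_right_inverse[OF U] by simp
  also have "\<dots> = U ** real_diagonal (vec_lambda l) ** U\<^sup>\<dagger>"
    by (simp add: matrix_mul_assoc AU)
  finally show thesis
    by (rule that[OF U])
qed

section \<open>The eigenvalue vector of a diagonalized matrix\<close>

text \<open>
  The usual similarity invariance, carried out for matrices of polynomials: constants embed as a
  ring homomorphism \<open>c\<close>, and the scalar matrix \<open>X\<close> commutes with everything.
\<close>

lemma char_polynomial_unitary_diagonal:
  fixes U :: "complex^'n^'n"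
  assumes "U\<^sup>\<dagger> ** U = mat 1"
  shows "char_polynomial (U ** real_diagonal l ** U\<^sup>\<dagger>) = (\<Prod>i\<in>UNIV. [:- of_real (l $ i), 1:])"
proof -
  define c :: "complex^'n^'n \<Rightarrow> complex poly^'n^'n" where "c = map_matrix (\<lambda>z. [:z:])"
  have const_sum: "[:sum f S:] = (\<Sum>k\<in>S. [:f k:])" for f :: "'n \<Rightarrow> complex" and S
    by (simp add: poly_eq_iff coeff_sum coeff_pCons split: nat.splits)
  have cmult: "c (A ** B) = c A ** c B" for A B
    by (simp add: c_def vec_eq_iff matrix_matrix_mult_def const_sum mult.commute)
  have UU: "c U ** c (U\<^sup>\<dagger>) = mat 1"
    using unitary_right_inverse[OF assms] by (simp flip: cmult) (simp add: c_def mat_def vec_eq_iff)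
  let ?X = "mat [:0, 1:] :: complex poly^'n^'n"
  have X_comm: "M ** ?X = ?X ** M" for M
    by (simp add: vec_eq_iff matrix_matrix_mult_def mat_def if_distrib if_distribR cong: if_cong)
  have char: "char_polynomial A = det (?X - c A)" for A
    by (auto simp: char_polynomial_def c_def mat_def intro!: arg_cong[of _ _ det] simp: vec_eq_iff)
  have sub: "M ** (P - Q) ** N = M ** P ** N - M ** Q ** N" for M N P Q :: "complex poly^'n^'n"
    by (simp add: vec_eq_iff matrix_matrix_mult_def algebra_simps sum_subtractf)
  have "?X = c U ** ?X ** c (U\<^sup>\<dagger>)"
    by (simp add: X_comm UU flip: matrix_mul_assoc)
  then have "?X - c (U ** real_diagonal l ** U\<^sup>\<dagger>) = c U ** (?X - c (real_diagonal l)) ** c (U\<^sup>\<dagger>)"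
    by (simp only: cmult sub)
  then have "char_polynomial (U ** real_diagonal l ** U\<^sup>\<dagger>)
      = det (c U) * det (c (U\<^sup>\<dagger>)) * det (?X - c (real_diagonal l))"
    by (simp only: char det_mul mult_ac)
  also have "det (c U) * det (c (U\<^sup>\<dagger>)) = 1"
    by (simp add: UU flip: det_mul)
  also have "det (?X - c (real_diagonal l)) = (\<Prod>i\<in>UNIV. [:- of_real (l $ i), 1:])"
    by (subst det_diagonal) (simp_all add: c_def mat_def real_diagonal_def)
  finally show ?thesis by simp
qed

lemma real_eigenvalues_unitary_diagonal:
  fixes U :: "complex^'n^'n"
  assumes "U\<^sup>\<dagger> ** U = mat 1"
  shows "real_eigenvalues (U ** real_diagonal l ** U\<^sup>\<dagger>) = image_mset (($) l) (mset_set UNIV)"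
proof -
  have "proots (\<Prod>i\<in>UNIV. [:- complex_of_real (l $ i), 1:]) = (\<Sum>i\<in>UNIV. {#complex_of_real (l $ i)#})"
    by (subst proots_prod) auto
  also have "\<dots> = image_mset (\<lambda>i. complex_of_real (l $ i)) (mset_set UNIV)"
    by (simp add: sum_unfold_sum_mset)
  finally show ?thesis
    by (simp add: real_eigenvalues_def char_polynomial_unitary_diagonal[OF assms] image_mset.compositionality o_def)
qed

definition decreasing :: "real^('d::{finite, linorder}) \<Rightarrow> bool" where
  "decreasing l \<longleftrightarrow> (\<forall>i j. i \<le> j \<longrightarrow> l $ j \<le> l $ i)"

lemma card_lessThan_mono:
  fixes i j :: "'d::{finite, linorder}"
  shows "i \<le> j \<Longrightarrow> card {..<i} \<le> card {..<j}"
  by (intro card_mono) auto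

lemma card_lessThan_strict_mono:
  fixes i j :: "'d::{finite, linorder}"
  shows "i < j \<Longrightarrow> card {..<i} < card {..<j}"
  by (intro psubset_card_mono) auto

lemma bij_betw_card_lessThan:
  "bij_betw (\<lambda>i::'d::{finite, linorder}. card {..<i}) UNIV {..<CARD('d)}"
proof -
  have inj: "inj (\<lambda>i::'d. card {..<i})"
    by (rule injI) (metis card_lessThan_strict_mono less_irrefl neqE)
  have "card {..<i} < CARD('d)" for i :: 'd
    by (intro psubset_card_mono) auto
  then have "(\<lambda>i::'d. card {..<i}) ` UNIV = {..<CARD('d)}"
    by (intro card_subset_eq) (auto simp: card_image[OF inj])
  with inj show ?thesis by (simp add: bij_betw_def)
qed

text \<open>
  The map \<open>i \<mapsto> card {..<i}\<close> is the order isomorphism onto the list positions that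
  \<^const>\<open>eigenvalue_vector\<close> uses.
\<close>

lemma sorted_list_of_set_UNIV_nth:
  fixes i :: "'d::{finite, linorder}"
  shows "sorted_list_of_set UNIV ! card {..<i} = i"
proof -
  let ?L = "sorted_list_of_set (UNIV :: 'd set)"
  obtain k where k: "k < length ?L" "?L ! k = i"
    by (metis UNIV_I finite in_set_conv_nth set_sorted_list_of_set)
  have strict: "?L ! a < ?L ! b \<longleftrightarrow> a < b" if "a < length ?L" "b < length ?L" for a b
    using that strict_sorted_list_of_set[of "UNIV :: 'd set"]
    by (metis not_less_iff_gr_or_eq sorted_wrt_nth_less)
  have "{..<i} = (!) ?L ` {..<k}"
  proof (intro equalityI subsetI)
    fix j assume "j \<in> {..<i}"
    moreover obtain m where "m < length ?L" "?L ! m = j"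
      by (metis UNIV_I finite in_set_conv_nth set_sorted_list_of_set)
    ultimately show "j \<in> (!) ?L ` {..<k}"
      using strict[of m k] k by auto
  qed (use strict[of _ k] k in auto)
  moreover have "inj_on ((!) ?L) {..<k}"
    using k(1) by (intro inj_on_nth) auto
  ultimately have "card {..<i} = k"
    by (simp add: card_image)
  with k show ?thesis by simp
qed

text \<open>
  A unitary diagonalization with decreasing entries determines the eigenvalue vector. All later
  arguments reach \<^const>\<open>eigenvalue_vector\<close> through this lemma and its converse
  \<open>eigenvalue_vector_diagonalization\<close>, never through characteristic polynomials.
\<close>

lemma eigenvalue_vector_unitary_diagonal:
  fixes U :: "complex^('d::{finite, linorder})^('d::{finite, linorder})"
  assumes "U\<^sup>\<dagger> ** U = mat 1" "decreasing l"
  shows "eigenvalue_vector (U ** real_diagonal l ** U\<^sup>\<dagger>) = l"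
proof -
  let ?L = "sorted_list_of_set (UNIV :: 'd set)"
  have "sorted (rev (map (($) l) ?L))"
    unfolding sorted_wrt_rev sorted_wrt_map
    by (rule sorted_wrt_mono_rel[OF _ sorted_sorted_list_of_set[of "UNIV :: 'd set"]])
       (use assms(2) in \<open>auto simp: decreasing_def\<close>)
  then have "sort (rev (map (($) l) ?L)) = rev (map (($) l) ?L)"
    by (rule sorted_sort_id)
  moreover have "real_eigenvalues (U ** real_diagonal l ** U\<^sup>\<dagger>) = mset (rev (map (($) l) ?L))"
    using mset_set_set[of ?L] by (simp add: real_eigenvalues_unitary_diagonal[OF assms(1)])
  ultimately have "rev (sorted_list_of_multiset (real_eigenvalues (U ** real_diagonal l ** U\<^sup>\<dagger>)))
      = map (($) l) ?L"
    by (simp only: sorted_list_of_multiset_mset rev_rev_ident)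
  moreover have "card {..<i} < CARD('d)" for i :: 'd
    using bij_betw_card_lessThan by (auto simp: bij_betw_def)
  ultimately show ?thesis
    by (simp add: eigenvalue_vector_def vec_eq_iff sorted_list_of_set_UNIV_nth)
qed

lemma eigenvalue_vector_diagonalization:
  fixes A :: "complex^('d::{finite, linorder})^('d::{finite, linorder})"
  assumes "A\<^sup>\<dagger> = A"
  obtains U :: "complex^('d::{finite, linorder})^('d::{finite, linorder})"
  where "U\<^sup>\<dagger> ** U = mat 1" "A = U ** real_diagonal (eigenvalue_vector A) ** U\<^sup>\<dagger>"
    "decreasing (eigenvalue_vector A)"
proof -
  obtain U :: "complex^('d::{finite, linorder})^('d::{finite, linorder})" and l
    where U: "U\<^sup>\<dagger> ** U = mat 1" and A: "A = U ** real_diagonal l ** U\<^sup>\<dagger>"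
    by (rule self_adjoint_diagonalization[OF assms])
  define xs where "xs = sort_key (\<lambda>i::'d. - l $ i) (sorted_list_of_set (UNIV :: 'd set))"
  have xs: "set xs = UNIV" "distinct xs" "length xs = CARD('d)" "sorted (map (\<lambda>i. - l $ i) xs)"
    by (simp_all add: xs_def)
  define p where "p i = xs ! card {..<i}" for i :: 'd
  have "bij_betw ((!) xs) {..<CARD('d)} UNIV"
    by (rule bij_betw_nth) (use xs in auto)
  then have p: "bij p"
    using bij_betw_trans[OF bij_betw_card_lessThan] by (simp add: p_def[abs_def] o_def)
  define V where "V = (\<chi> i j. U $ i $ p j)"
  define m where "m = (\<chi> j. l $ p j)"
  have "V\<^sup>\<dagger> ** V = mat 1"
    using U p by (simp add: vec_eq_iff gram_nth) (simp add: V_def cinner_def column_def mat_def bij_def inj_eq matrix_matrix_mult_def)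
  moreover have "A = V ** real_diagonal m ** V\<^sup>\<dagger>"
  proof -
    have "A $ i $ j = (\<Sum>k\<in>UNIV. U $ i $ k * of_real (l $ k) * cnj (U $ j $ k))" for i j
      by (simp add: A matrix_matrix_mult_def[of "_ ** _"] mult_real_diagonal_nth)
    moreover have "\<dots> i j = (\<Sum>k\<in>UNIV. U $ i $ p k * of_real (l $ p k) * cnj (U $ j $ p k))" for i j
      using p by (intro sum.reindex_bij_betw[symmetric]) 
    ultimately show ?thesis
      by (simp add: vec_eq_iff matrix_matrix_mult_def[of "_ ** _"] mult_real_diagonal_nth) (simp add: V_def m_def)
  qed
  moreover have "decreasing m"
    unfolding decreasing_def
  proof (intro allI impI)
    fix i j :: 'd assume "i \<le> j"
    then have "card {..<i} \<le> card {..<j}" by (rule card_lessThan_mono)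
    moreover have "card {..<j} < CARD('d)"
      using bij_betw_card_lessThan by (auto simp: bij_betw_def)
    ultimately show "m $ j \<le> m $ i"
      using sorted_nth_mono[OF xs(4), of "card {..<i}" "card {..<j}"] xs(3) by (simp add: m_def p_def)
  qed
  ultimately show thesis
    using that eigenvalue_vector_unitary_diagonal by metis
qed

section \<open>Weyl's inequality\<close>

lemma quadratic_form_unitary_diagonal:
  fixes A :: "complex^'k^'n"
  shows "x \<bullet> ((A ** real_diagonal a ** A\<^sup>\<dagger>) *v x)
    = (\<Sum>k\<in>UNIV. a $ k * (cmod (cinner (column k A) x))\<^sup>2)"
proof -
  define y where "y = A\<^sup>\<dagger> *v x"
  have y: "y $ k = cinner (column k A) x" for k
    by (simp add: y_def matrix_vector_mult_def cinner_def column_def)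
  have "x \<bullet> ((A ** real_diagonal a ** A\<^sup>\<dagger>) *v x) = y \<bullet> (real_diagonal a *v y)"
    by (simp add: y_def inner_adjoint flip: matrix_vector_mul_assoc)
  also have "\<dots> = (\<Sum>k\<in>UNIV. a $ k * (cmod (y $ k))\<^sup>2)"
    unfolding inner_vec_def
  proof (intro sum.cong refl)
    fix k
    have "(real_diagonal a *v y) $ k = a $ k *\<^sub>R y $ k"
      by (simp add: matrix_vector_mult_def real_diagonal_def if_distrib if_distribR scaleR_conv_of_real cong: if_cong)
    then show "y $ k \<bullet> (real_diagonal a *v y) $ k = a $ k * (cmod (y $ k))\<^sup>2"
      by (simp add: power2_norm_eq_inner)
  qed
  finally show ?thesis by (simp add: y)
qed

lemma parseval:
  fixes U :: "complex^'n^'n"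
  assumes "U\<^sup>\<dagger> ** U = mat 1"
  shows "x \<bullet> x = (\<Sum>k\<in>UNIV. (cmod (cinner (column k U) x))\<^sup>2)"
proof -
  have "real_diagonal 1 = (mat 1 :: complex^'n^'n)"
    by (simp add: real_diagonal_def mat_def vec_eq_iff)
  then show ?thesis
    using quadratic_form_unitary_diagonal[of x U 1] unitary_right_inverse[OF assms] by simp
qed

text \<open>
  The test vector is orthogonal to the eigenvectors of the first matrix after \<open>i\<close> and to those of
  the second matrix before \<open>i\<close>. These are one condition fewer than the dimension, and on such a vector
  the first form is at least \<open>a $ i\<close> and the second at most \<open>b $ i\<close>.
\<close>

lemma weyl_inequality_diagonal:
  fixes U W :: "complex^('d::{finite, linorder})^('d::{finite, linorder})"
  assumes U: "U\<^sup>\<dagger> ** U = mat 1" and W: "W\<^sup>\<dagger> ** W = mat 1" and "decreasing a" "decreasing b"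
    and le: "\<And>x. x \<bullet> ((U ** real_diagonal a ** U\<^sup>\<dagger>) *v x) \<le> x \<bullet> ((W ** real_diagonal b ** W\<^sup>\<dagger>) *v x) + e * (x \<bullet> x)"
  shows "a $ i \<le> b $ i + e"
proof -
  define c where "c k = (if k < i then column k W else column k U)" for k
  have "card (- {i}) < CARD('d)"
    by (intro psubset_card_mono) auto
  then obtain x where x: "norm x = 1" "\<forall>k\<in>-{i}. cinner (c k) x = 0"
    using orthogonal_unit_vector_exists[of "- {i}" c] by auto
  have xU: "cinner (column k U) x = 0" if "i < k" for k
    using x(2) that by (metis ComplI c_def less_asym singletonD less_irrefl)
  have xW: "cinner (column k W) x = 0" if "k < i" for k
    using x(2) that by (metis ComplI c_def less_asym singletonD less_irrefl)
  have xx: "x \<bullet> x = 1" using x(1) by (simp add: dot_square_norm)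
  have "a $ i = (\<Sum>k\<in>UNIV. a $ i * (cmod (cinner (column k U) x))\<^sup>2)"
    using parseval[OF U, of x] xx by (simp flip: sum_distrib_left)
  also have "\<dots> \<le> (\<Sum>k\<in>UNIV. a $ k * (cmod (cinner (column k U) x))\<^sup>2)"
  proof (intro sum_mono)
    fix k show "a $ i * (cmod (cinner (column k U) x))\<^sup>2 \<le> a $ k * (cmod (cinner (column k U) x))\<^sup>2"
      using assms(3) xU[of k] by (cases "i < k") (auto simp: decreasing_def intro: mult_right_mono)
  qed
  also have "\<dots> \<le> (\<Sum>k\<in>UNIV. b $ k * (cmod (cinner (column k W) x))\<^sup>2) + e"
    using le[of x] xx by (simp add: quadratic_form_unitary_diagonal)
  also have "(\<Sum>k\<in>UNIV. b $ k * (cmod (cinner (column k W) x))\<^sup>2)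
      \<le> (\<Sum>k\<in>UNIV. b $ i * (cmod (cinner (column k W) x))\<^sup>2)"
  proof (intro sum_mono)
    fix k show "b $ k * (cmod (cinner (column k W) x))\<^sup>2 \<le> b $ i * (cmod (cinner (column k W) x))\<^sup>2"
      using assms(4) xW[of k] by (cases "k < i") (auto simp: decreasing_def intro: mult_right_mono)
  qed
  also have "\<dots> = b $ i"
    using parseval[OF W, of x] xx by (simp flip: sum_distrib_left)
  finally show ?thesis by simp
qed

text \<open>
  Only the Lipschitz property matters here: a perturbation of size \<open>o(s\<^sup>2)\<close> of the frame operator
  moves the sorted spectrum by \<open>o(s\<^sup>2)\<close>, also where eigenvalues coincide.
\<close>

lemma weyl_inequality:
  obtains K where "\<And>(A :: complex^('d::{finite, linorder})^('d::{finite, linorder})) B i. A\<^sup>\<dagger> = A \<Longrightarrow> B\<^sup>\<dagger> = B \<Longrightarrow>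
    \<bar>eigenvalue_vector A $ i - eigenvalue_vector B $ i\<bar> \<le> norm (A - B) * K"
proof -
  have "bilinear ((*v) :: complex^('d::{finite, linorder})^('d::{finite, linorder}) \<Rightarrow> _)"
    unfolding bilinear_def
    by (auto intro!: linearI simp: vec_eq_iff matrix_vector_mult_def algebra_simps sum.distrib
        scaleR_sum_right)
  then have bb: "bounded_bilinear ((*v) :: complex^('d::{finite, linorder})^('d::{finite, linorder}) \<Rightarrow> _)"
    by (simp add: bilinear_conv_bounded_bilinear)
  from bounded_bilinear.bounded[OF this] obtain K
    where K: "\<And>(M :: complex^('d::{finite, linorder})^('d::{finite, linorder})) x. norm (M *v x) \<le> norm M * norm x * K" by blast
  have le: "x \<bullet> (A *v x) \<le> x \<bullet> (B *v x) + norm (A - B) * K * (x \<bullet> x)" for A B :: "complex^('d::{finite, linorder})^('d::{finite, linorder})" and x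
  proof -
    have "x \<bullet> (A *v x) - x \<bullet> (B *v x) = x \<bullet> ((A - B) *v x)"
      by (simp add: bounded_bilinear.diff_left[OF bb] inner_diff)
    also have "\<dots> \<le> norm x * norm ((A - B) *v x)"
      by (rule norm_cauchy_schwarz)
    also have "\<dots> \<le> norm x * (norm (A - B) * norm x * K)"
      by (intro mult_left_mono K) auto
    finally show ?thesis
      by (simp add: dot_square_norm power2_eq_square mult_ac)
  qed
  have half: "eigenvalue_vector A $ i \<le> eigenvalue_vector B $ i + norm (A - B) * K"
    if "A\<^sup>\<dagger> = A" "B\<^sup>\<dagger> = B" for A B :: "complex^('d::{finite, linorder})^('d::{finite, linorder})" and i
  proof -
    obtain U where U: "U\<^sup>\<dagger> ** U = mat 1" "A = U ** real_diagonal (eigenvalue_vector A) ** U\<^sup>\<dagger>"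
      "decreasing (eigenvalue_vector A)"
      using eigenvalue_vector_diagonalization[OF \<open>A\<^sup>\<dagger> = A\<close>] .
    obtain W where W: "W\<^sup>\<dagger> ** W = mat 1" "B = W ** real_diagonal (eigenvalue_vector B) ** W\<^sup>\<dagger>"
      "decreasing (eigenvalue_vector B)"
      using eigenvalue_vector_diagonalization[OF \<open>B\<^sup>\<dagger> = B\<close>] .
    show ?thesis
      using weyl_inequality_diagonal[OF U(1) W(1) U(3) W(3)] le[of _ A B] U(2) W(2) by metis
  qed
  have "\<bar>eigenvalue_vector A $ i - eigenvalue_vector B $ i\<bar> \<le> norm (A - B) * K"
    if "A\<^sup>\<dagger> = A" "B\<^sup>\<dagger> = B" for A B :: "complex^('d::{finite, linorder})^('d::{finite, linorder})" and i
    using half[OF that, of i] half[OF that(2,1), of i] by (simp add: norm_minus_commute[of B])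
  then show thesis
    by (rule that)
qed

section \<open>Correcting the diagonal of a Gram matrix\<close>

text \<open>
  These weights are the diagonal matrices commuting with \<open>G\<close>. They are constant on the connected
  components of the graph that joins \<open>i\<close> and \<open>j\<close> when \<open>G $ i $ j \<noteq> 0\<close>.
\<close>

definition compatible_weights :: "complex^'n^'n \<Rightarrow> real^'n \<Rightarrow> bool" where
  "compatible_weights G k \<longleftrightarrow> (\<forall>i j. G $ i $ j \<noteq> 0 \<longrightarrow> k $ i = k $ j)"

text \<open>
  Components are described by the weights that cannot separate their elements, which makes the
  equivalence relation and the constancy of compatible weights immediate.
\<close>

definition component :: "complex^'n^'n \<Rightarrow> 'n \<Rightarrow> 'n set" where
  "component G i = {j. \<forall>k. compatible_weights G k \<longrightarrow> k $ i = k $ j}"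

lemma component_self: "i \<in> component G i"
  by (simp add: component_def)

lemma component_eq_iff: "component G i = component G j \<longleftrightarrow> j \<in> component G i"
  unfolding component_def by (auto simp: set_eq_iff)

lemma component_eqI:
  assumes "G $ i $ j \<noteq> 0"
  shows "component G i = component G j"
  using assms unfolding component_eq_iff by (auto simp: component_def compatible_weights_def)

lemma compatible_weights_component:
  "compatible_weights G k \<Longrightarrow> component G i = component G j \<Longrightarrow> k $ i = k $ j"
  unfolding component_eq_iff by (simp add: component_def)

lemma self_adjoint_nth: "A\<^sup>\<dagger> = A \<Longrightarrow> cnj (A $ i $ j) = A $ j $ i"
  by (metis conj_transpose_nth)

lemma self_adjoint_diagonal_real: "A\<^sup>\<dagger> = A \<Longrightarrow> A $ i $ i = of_real (Re (A $ i $ i))"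
  using self_adjoint_nth[of A i i] by (simp add: complex_eq_iff)

text \<open>
  The diagonals of the commutators \<open>[G, N]\<close>, \<open>N\<close> skew, form a subspace \<open>R\<close>. A weight \<open>k\<close> orthogonal to
  it can be tested against \<open>C = [D\<^sub>k, G]\<close>, which is skew: the pairing of \<open>k\<close> with the diagonal of
  \<open>[G, C]\<close> is \<open>tr (C\<^sup>2) = - \<parallel>C\<parallel>\<^sup>2\<close>. So \<open>C = 0\<close>, that is, \<open>k\<close> is compatible, and \<open>R\<close> is
  everything orthogonal to the compatible weights.
\<close>

lemma commutator_diagonal_solvable:
  fixes G :: "complex^'n^'n"
  assumes G: "G\<^sup>\<dagger> = G" and orth: "\<And>k. compatible_weights G k \<Longrightarrow> k \<bullet> r = 0"
  obtains N where "N\<^sup>\<dagger> = - N" "\<And>i. (G ** N - N ** G) $ i $ i = of_real (r $ i)"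
proof -
  define F where "F N = (\<chi> i. Re ((G ** N - N ** G) $ i $ i))" for N
  define R where "R = F ` {N. N\<^sup>\<dagger> = - N}"
  have "linear F"
    by (rule linearI) (simp_all add: F_def vec_eq_iff matrix_mult_bilinear algebra_simps)
  moreover have "subspace {N :: complex^'n^'n. N\<^sup>\<dagger> = - N}"
    by (simp add: subspace_def conj_transpose_linear) (simp add: vec_eq_iff)
  ultimately have R: "subspace R"
    unfolding R_def by (rule linear_subspace_image)
  have weights: "compatible_weights G k" if k: "k \<in> R\<^sup>\<bottom>" for k
  proof -
    let ?D = "real_diagonal k"
    define C where "C = ?D ** G - G ** ?D"
    have C: "C\<^sup>\<dagger> = - C"
      by (simp add: C_def conj_transpose_linear conj_transpose_mult G)
    then have "F C \<in> R"
      by (simp add: R_def)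
    then have "0 = k \<bullet> F C"
      using k by (simp add: orthogonal_comp_def orthogonal_def inner_commute[of k])
    also have "\<dots> = Re (trace (?D ** (G ** C - C ** G)))"
      by (simp add: inner_vec_def F_def trace_def real_diagonal_mult_nth)
    also have "trace (?D ** (G ** C - C ** G)) = trace (?D ** G ** C) - trace ((?D ** C) ** G)"
      by (simp add: matrix_mult_bilinear matrix_mul_assoc trace_sub)
    also have "trace ((?D ** C) ** G) = trace (G ** ?D ** C)"
      by (subst trace_mul_sym) (simp add: matrix_mul_assoc)
    also have "trace (?D ** G ** C) - trace (G ** ?D ** C) = trace (C ** C)"
      by (simp add: C_def matrix_mult_bilinear trace_sub)
    also have "C ** C = - (C\<^sup>\<dagger> ** C)"
      by (simp add: C matrix_mult_bilinear)
    also have "Re (trace (- (C\<^sup>\<dagger> ** C))) = - (\<Sum>j\<in>UNIV. \<Sum>i\<in>UNIV. (cmod (C $ i $ j))\<^sup>2)"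
      by (simp add: trace_def matrix_matrix_mult_def sum_negf cmod_power2 flip: power2_eq_square)
    finally have "(\<Sum>j\<in>UNIV. \<Sum>i\<in>UNIV. (cmod (C $ i $ j))\<^sup>2) = 0"
      by simp
    then have "C $ i $ j = 0" for i j
      by (simp add: sum_nonneg_eq_0_iff sum_nonneg)
    then have "(of_real (k $ i) - of_real (k $ j)) * G $ i $ j = 0" for i j
      by (simp add: C_def real_diagonal_mult_nth mult_real_diagonal_nth algebra_simps)
    then show ?thesis
      unfolding compatible_weights_def by force
  qed
  have "r \<in> R\<^sup>\<bottom>\<^sup>\<bottom>"
    using orth weights by (simp add: orthogonal_comp_def[of "R\<^sup>\<bottom>"] orthogonal_def inner_commute)
  then have "r \<in> R"
    by (simp add: orthogonal_comp_self[OF R])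
  then obtain N where N: "N\<^sup>\<dagger> = - N" "F N = r"
    by (auto simp: R_def)
  have "(G ** N - N ** G)\<^sup>\<dagger> = G ** N - N ** G"
    by (simp add: conj_transpose_linear conj_transpose_mult G N(1) matrix_mult_bilinear)
  from self_adjoint_diagonal_real[OF this]
  have "(G ** N - N ** G) $ i $ i = of_real (F N $ i)" for i
    by (simp only: F_def vec_lambda_beta)
  with N show thesis
    using that by metis
qed

definition supported_on :: "'n set \<Rightarrow> complex^'n \<Rightarrow> bool" where
  "supported_on c x \<longleftrightarrow> (\<forall>i. i \<notin> c \<longrightarrow> x $ i = 0)"

text \<open>
  The factor \<open>s\<close> selects the largest (\<open>s > 0\<close>) or the smallest (\<open>s < 0\<close>) eigenvalue of \<open>G\<close> among
  vectors supported on one component; this subspace is invariant because \<open>G\<close> has no entries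
  between different components.
\<close>

lemma component_extremal_eigenvector:
  fixes G :: "complex^'n^'n"
  assumes G: "G\<^sup>\<dagger> = G" and s: "s \<noteq> 0"
  obtains x l where "supported_on (component G i) x" "norm x = 1" "G *v x = l *\<^sub>R x"
    "\<And>y. supported_on (component G i) y \<Longrightarrow> s * (y \<bullet> (G *v y)) \<le> s * l * (y \<bullet> y)"
proof -
  interpret linear "(*v) G" by (rule linear_matrix_vector)
  define V where "V = {x. supported_on (component G i) x}"
  define T where "T x = s *\<^sub>R (G *v x)" for x
  have T: "linear T"
    by (rule linearI) (simp_all add: T_def add scaleR algebra_simps)
  have sym: "x \<bullet> T y = T x \<bullet> y" for x y
    by (simp add: T_def inner_adjoint G)
  have V: "subspace V"
    by (simp add: V_def supported_on_def subspace_def)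
  have G_V: "G *v x \<in> V" if "x \<in> V" for x
  proof -
    have "(G *v x) $ k = 0" if k: "k \<notin> component G i" for k
      unfolding matrix_vector_mult_def vec_lambda_beta
    proof (intro sum.neutral ballI)
      fix l show "G $ k $ l * x $ l = 0"
        using k \<open>x \<in> V\<close> component_eqI[of G k l]
        by (metis V_def component_eq_iff mem_Collect_eq mult_eq_0_iff supported_on_def)
    qed
    then show ?thesis by (simp add: V_def supported_on_def)
  qed
  have "axis i 1 \<in> V" "axis i (1::complex) \<noteq> 0"
    using component_self[of i G] by (auto simp: V_def supported_on_def axis_def vec_eq_iff)
  moreover have "T x \<in> V" if "x \<in> V" for x
    using G_V[OF that] V by (simp add: T_def subspace_scale)
  ultimately obtain x m where x: "x \<in> V" "norm x = 1" "T x = m *\<^sub>R x" "\<And>y. y \<in> V \<Longrightarrow> y \<bullet> T y \<le> m * (y \<bullet> y)"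
    using rayleigh_maximum[OF T sym V] by metis
  show thesis
  proof (rule that)
    show "supported_on (component G i) x" "norm x = 1"
      using x by (auto simp: V_def)
    show "G *v x = (m / s) *\<^sub>R x"
    proof -
      have "s *\<^sub>R (G *v x) = s *\<^sub>R ((m / s) *\<^sub>R x)"
        using x(3) s by (simp add: T_def)
      then show ?thesis using s by (simp only: scaleR_cancel_left) simp
    qed
    show "s * (y \<bullet> (G *v y)) \<le> s * (m / s) * (y \<bullet> y)" if "supported_on (component G i) y" for y
      using x(4)[of y] that s by (simp add: V_def T_def)
  qed
qed

text \<open>
  The diagonal entries \<open>1\<close> are values of the Rayleigh quotient, so each component carries an eigenvalue
  \<open>\<ge> 1\<close> (for \<open>s = 1\<close>) and one \<open>\<le> 1\<close> (for \<open>s = - 1\<close>).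
\<close>

lemma component_eigenvector:
  fixes G :: "complex^'n^'n"
  assumes "G\<^sup>\<dagger> = G" "G $ i $ i = 1" "s \<noteq> 0"
  obtains x l where "supported_on (component G i) x" "norm x = 1" "G *v x = l *\<^sub>R x" "s \<le> s * l"
proof -
  obtain x l where x: "supported_on (component G i) x" "norm x = 1" "G *v x = l *\<^sub>R x"
    and ext: "\<And>y. supported_on (component G i) y \<Longrightarrow> s * (y \<bullet> (G *v y)) \<le> s * l * (y \<bullet> y)"
    by (rule component_extremal_eigenvector[OF assms(1,3), where i = i]) blast
  have "supported_on (component G i) (axis i 1)"
    using component_self[of i G] by (auto simp: supported_on_def axis_def)
  moreover have "(G *v axis i 1) $ i = 1"
    using assms(2) by (simp add: matrix_vector_mult_def axis_def if_distrib cong: if_cong)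
  then have "axis i 1 \<bullet> (G *v axis i 1) = 1"
    by (simp only: inner_axis') simp
  ultimately have "s \<le> s * l"
    using ext[of "axis i 1"] by (simp add: dot_square_norm)
  with x show thesis by (rule that)
qed

text \<open>
  With a non-zero off-diagonal entry the inequalities become strict: the vectors \<open>e\<^sub>a + t e\<^sub>b\<close>, with the
  phase of \<open>t\<close> chosen to make \<open>G $ a $ b * t = s * cmod (G $ a $ b)\<close>, have Rayleigh quotient
  \<open>1 + s * cmod (G $ a $ b)\<close>.
\<close>

lemma component_eigenvector_strict:
  fixes G :: "complex^'n^'n"
  assumes G: "G\<^sup>\<dagger> = G" "\<And>i. G $ i $ i = 1" and s: "s = 1 \<or> s = -1"
    and ab: "a \<noteq> b" "G $ a $ b \<noteq> 0"
  obtains x l where "supported_on (component G a) x" "norm x = 1" "G *v x = l *\<^sub>R x" "s < s * l"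
proof -
  have "s \<noteq> 0" using s by auto
  obtain x l where x: "supported_on (component G a) x" "norm x = 1" "G *v x = l *\<^sub>R x"
    and ext: "\<And>y. supported_on (component G a) y \<Longrightarrow> s * (y \<bullet> (G *v y)) \<le> s * l * (y \<bullet> y)"
    by (rule component_extremal_eigenvector[OF G(1) \<open>s \<noteq> 0\<close>, where i = a]) blast
  define g where "g = G $ a $ b"
  have g: "cmod g > 0" using ab(2) by (simp add: g_def)
  define t where "t = of_real (s / cmod g) * cnj g"
  have gt: "g * t = of_real (s * cmod g)"
  proof -
    have "g * t = of_real (s / cmod g) * (g * cnj g)"
      by (simp only: t_def mult_ac)
    then show ?thesis
      using g by (simp add: mult_cnj_eq_cmod_square power2_eq_square)
  qed
  have tt: "cmod t = 1"
    using s g by (auto simp: t_def norm_mult norm_divide)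
  define y where "y = (\<chi> k. if k = a then 1 else if k = b then t else 0)"
  have ysum: "(\<Sum>k\<in>UNIV. f k * y $ k) = f a + f b * t" for f :: "'n \<Rightarrow> complex"
  proof -
    have "(\<Sum>k\<in>UNIV. f k * y $ k) = (\<Sum>k\<in>{a, b}. f k * y $ k)"
      by (rule sum.mono_neutral_right) (auto simp: y_def)
    then show ?thesis using ab(1) by (simp add: y_def)
  qed
  have "cinner y y = cnj (y $ a) + cnj (y $ b) * t"
    unfolding cinner_def by (rule ysum)
  also have "\<dots> = 1 + of_real ((cmod t)\<^sup>2)"
    using ab(1) mult_cnj_eq_cmod_square[of t] by (simp add: y_def mult.commute)
  finally have yy: "y \<bullet> y = 2"
    by (simp add: tt flip: Re_cinner)
  have Gy: "(G *v y) $ a = 1 + g * t" "(G *v y) $ b = cnj g + t"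
    using self_adjoint_nth[OF G(1), of a b]
    by (simp_all add: matrix_vector_mult_def ysum G(2) g_def)
  have "cinner y (G *v y) = cnj (cinner (G *v y) y)"
    by (simp add: cnj_cinner)
  also have "cinner (G *v y) y = cnj ((G *v y) $ a) + cnj ((G *v y) $ b) * t"
    unfolding cinner_def by (rule ysum)
  also have "cnj (cnj ((G *v y) $ a) + cnj ((G *v y) $ b) * t) = cnj (cnj (1 + g * t) + cnj (cnj g + t) * t)"
    by (simp only: Gy)
  also have "cnj (cnj (1 + g * t) + cnj (cnj g + t) * t) = 1 + g * t + cnj (g * t) + t * cnj t"
    by (simp add: algebra_simps)
  finally have yGy: "y \<bullet> (G *v y) = 2 + 2 * s * cmod g"
    by (simp add: gt mult_cnj_eq_cmod_square tt flip: Re_cinner)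
  have "supported_on (component G a) y"
    using component_self[of a G] component_eqI[OF ab(2), unfolded component_eq_iff]
    by (auto simp: supported_on_def y_def)
  from ext[OF this] have "s * (2 + 2 * s * cmod g) \<le> s * l * 2"
    by (simp add: yy yGy)
  then have "s < s * l"
    using s ab(2) g by (elim disjE) (simp_all del: zero_less_norm_iff)
  with x show thesis by (rule that)
qed

text \<open>
  For every amount \<open>\<sigma>\<close> of either sign there are an eigenvector on the component of \<open>a\<close> and one
  on the component of \<open>i\<close> whose interaction in \<open>diagonal_correction\<close> transfers exactly \<open>\<sigma>\<close>. The sign
  of \<open>\<sigma>\<close> decides which end of the spectrum is taken on each side; the strict inequality on the
  component of \<open>a\<close> keeps \<open>\<pi>\<close> and \<open>\<theta>\<close> apart.
\<close>

lemma supported_transfer_vectors: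
  fixes G :: "complex^'n^'n"
  assumes G: "G\<^sup>\<dagger> = G" "\<And>i. G $ i $ i = 1" and ab: "a \<noteq> b" "G $ a $ b \<noteq> 0"
  obtains p h \<pi> \<theta> where "supported_on (component G a) p" "norm p = 1" "G *v p = \<pi> *\<^sub>R p"
    "supported_on (component G i) h" "G *v h = \<theta> *\<^sub>R h" "(norm h)\<^sup>2 * (\<pi> - \<theta>) = \<sigma>"
proof -
  define s :: real where "s = (if \<sigma> \<ge> 0 then 1 else -1)"
  have s: "s = 1 \<or> s = -1" "- s \<noteq> 0" by (auto simp: s_def)
  obtain p \<pi> where p: "supported_on (component G a) p" "norm p = 1" "G *v p = \<pi> *\<^sub>R p" "s < s * \<pi>"
    by (rule component_eigenvector_strict[OF G s(1) ab])
  obtain q \<theta> where q: "supported_on (component G i) q" "norm q = 1" "G *v q = \<theta> *\<^sub>R q" "- s \<le> - s * \<theta>"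
    by (rule component_eigenvector[OF G s(2)])
  have "0 \<le> \<sigma> / (\<pi> - \<theta>)" and ne: "\<pi> \<noteq> \<theta>"
    using p(4) q(4) by (auto simp: s_def divide_simps split: if_splits)
  define h where "h = sqrt (\<sigma> / (\<pi> - \<theta>)) *\<^sub>R q"
  show thesis
  proof (rule that[of p \<pi> h \<theta>])
    show "supported_on (component G i) h"
      using q(1) by (simp add: h_def supported_on_def)
    interpret linear "(*v) G" by (rule linear_matrix_vector)
    show "G *v h = \<theta> *\<^sub>R h"
      by (simp add: h_def scaleR q(3))
    show "(norm h)\<^sup>2 * (\<pi> - \<theta>) = \<sigma>"
      using \<open>0 \<le> \<sigma> / (\<pi> - \<theta>)\<close> ne q(2) by (simp add: h_def)
  qed (use p in auto)
qed

text \<open>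
  Along \<open>Q\<^sub>s = 1 + s B + s\<^sup>2 P\<close>, which is unitary up to \<open>O(s\<^sup>3)\<close>, the matrix \<open>Q\<^sub>s\<^sup>\<dagger> (G + s\<^sup>2 H) Q\<^sub>s\<close> has the
  coefficients stated here at \<open>s\<close> and \<open>s\<^sup>2\<close>, so its diagonal stays \<open>1\<close> up to \<open>O(s\<^sup>3)\<close>.
  
  Taking \<open>P = N + B\<^sup>2 / 2\<close> with \<open>N\<close> skew, the \<open>s\<^sup>2\<close>-diagonal is that of \<open>H + [G, N] + R\<close>,
  \<open>R = (G B\<^sup>2 + B\<^sup>2 G) / 2 - B G B\<close>. By \<open>commutator_diagonal_solvable\<close> a suitable \<open>N\<close> exists as soon
  as the diagonal of \<open>H + R\<close> sums to zero over each component. The commutator cannot help with these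
  sums, so \<open>B\<close> has to. It connects a hub \<open>m\<close>, the component of \<open>a\<close>, with every other component: its
  columns outside \<open>m\<close> are multiples of eigenvectors \<open>p\<close> on \<open>m\<close>, weighted by the entries \<open>w\<close> of
  eigenvectors on the other components. Then \<open>R $ i $ i = (\<pi> i - \<theta> i) * (cmod (w i))\<^sup>2\<close> outside \<open>m\<close>, and
  the sum over \<open>m\<close> comes out right because \<open>H\<close> and \<open>R\<close> have trace \<open>0\<close>.
\<close>

lemma diagonal_correction:
  fixes G H :: "complex^'n^'n"
  assumes G: "G\<^sup>\<dagger> = G" "\<And>i. G $ i $ i = 1" and ab: "a \<noteq> b" "G $ a $ b \<noteq> 0"
    and H: "H\<^sup>\<dagger> = H" "trace H = 0"
  obtains B P where "B\<^sup>\<dagger> = - B" "P + P\<^sup>\<dagger> = B ** B"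
    "\<And>i. (G ** B - B ** G) $ i $ i = 0"
    "\<And>i. (H + P\<^sup>\<dagger> ** G + G ** P - B ** G ** B) $ i $ i = 0"
proof -
  define m where "m = component G a"
  \<comment> \<open>the amount that \<open>R\<close> has to contribute to the diagonal on the component \<open>c\<close>\<close>
  define \<sigma> where "\<sigma> c = - (\<Sum>k\<in>c. Re (H $ k $ k))" for c
  have "\<forall>c\<in>range (component G). \<exists>p h \<pi> \<theta>. supported_on m p \<and> norm p = 1 \<and> G *v p = \<pi> *\<^sub>R p \<and>
    supported_on c h \<and> G *v h = \<theta> *\<^sub>R h \<and> (norm h)\<^sup>2 * (\<pi> - \<theta>) = \<sigma> c"
  proof clarify
    fix i
    obtain p h \<pi> \<theta> where "supported_on m p" "norm p = 1" "G *v p = \<pi> *\<^sub>R p"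
      "supported_on (component G i) h" "G *v h = \<theta> *\<^sub>R h" "(norm h)\<^sup>2 * (\<pi> - \<theta>) = \<sigma> (component G i)"
      unfolding m_def by (rule supported_transfer_vectors[OF G ab])
    then show "\<exists>p h \<pi> \<theta>. supported_on m p \<and> norm p = 1 \<and> G *v p = \<pi> *\<^sub>R p \<and>
      supported_on (component G i) h \<and> G *v h = \<theta> *\<^sub>R h \<and> (norm h)\<^sup>2 * (\<pi> - \<theta>) = \<sigma> (component G i)"
      by blast
  qed
  then obtain p' h' \<pi>' \<theta>' where "\<forall>c\<in>range (component G). supported_on m (p' c) \<and> norm (p' c) = 1 \<and> G *v p' c = \<pi>' c *\<^sub>R p' c \<and>
    supported_on c (h' c) \<and> G *v h' c = \<theta>' c *\<^sub>R h' c \<and> (norm (h' c))\<^sup>2 * (\<pi>' c - \<theta>' c) = \<sigma> c"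
    by metis
  then have choice: "supported_on m (p' (component G i))" "norm (p' (component G i)) = 1"
    "G *v p' (component G i) = \<pi>' (component G i) *\<^sub>R p' (component G i)"
    "supported_on (component G i) (h' (component G i))"
    "G *v h' (component G i) = \<theta>' (component G i) *\<^sub>R h' (component G i)"
    "(norm (h' (component G i)))\<^sup>2 * (\<pi>' (component G i) - \<theta>' (component G i)) = \<sigma> (component G i)" for i
    by auto
  define p where "p i = p' (component G i)" for i
  define \<pi> where "\<pi> i = \<pi>' (component G i)" for i
  define \<theta> where "\<theta> i = \<theta>' (component G i)" for i
  define w where "w i = h' (component G i) $ i" for i
  have p_supp: "p i $ j = 0" if "j \<notin> m" for i j
    using choice(1)[of i] that by (simp add: p_def supported_on_def)
  have p_eig: "(\<Sum>l\<in>UNIV. G $ k $ l * p i $ l) = of_real (\<pi> i) * p i $ k" for i k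
    using arg_cong[OF choice(3)[of i], of "\<lambda>x. x $ k"]
    by (simp add: matrix_vector_mult_def p_def \<pi>_def) (simp add: scaleR_conv_of_real)
  have p_unit: "(\<Sum>k\<in>UNIV. cnj (p i $ k) * p i $ k) = 1" for i
    using cinner_self[of "p i"] choice(2)[of i] by (simp add: cinner_def p_def)
  have w_eig: "(\<Sum>k\<in>UNIV. G $ i $ k * w k) = of_real (\<theta> i) * w i" for i
  proof -
    have "(\<Sum>k\<in>UNIV. G $ i $ k * w k) = (\<Sum>k\<in>UNIV. G $ i $ k * h' (component G i) $ k)"
    proof (intro sum.cong refl)
      fix k show "G $ i $ k * w k = G $ i $ k * h' (component G i) $ k"
        using component_eqI[of G i k] by (cases "G $ i $ k = 0") (auto simp: w_def)
    qed
    also have "\<dots> = of_real (\<theta> i) * w i"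
      using arg_cong[OF choice(5)[of i], of "\<lambda>x. x $ i"]
      by (simp add: matrix_vector_mult_def w_def \<theta>_def) (simp add: scaleR_conv_of_real)
    finally show ?thesis .
  qed
  have w_mass: "(\<Sum>k\<in>component G i. (\<pi> k - \<theta> k) * (cmod (w k))\<^sup>2) = \<sigma> (component G i)" for i
  proof -
    have "(\<Sum>k\<in>component G i. (\<pi> k - \<theta> k) * (cmod (w k))\<^sup>2)
      = (\<pi>' (component G i) - \<theta>' (component G i)) * (\<Sum>k\<in>component G i. (cmod (h' (component G i) $ k))\<^sup>2)"
      unfolding sum_distrib_left
    proof (intro sum.cong refl)
      fix k assume "k \<in> component G i"
      then have "component G k = component G i"
        using component_eq_iff by metis
      then show "(\<pi> k - \<theta> k) * (cmod (w k))\<^sup>2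
        = (\<pi>' (component G i) - \<theta>' (component G i)) * (cmod (h' (component G i) $ k))\<^sup>2"
        by (simp add: \<pi>_def \<theta>_def w_def)
    qed
    also have "(\<Sum>k\<in>component G i. (cmod (h' (component G i) $ k))\<^sup>2) = (norm (h' (component G i)))\<^sup>2"
      unfolding norm_square_eq_sum
      using choice(4)[of i] by (intro sum.mono_neutral_left) (auto simp: supported_on_def)
    finally show ?thesis
      using choice(6)[of i] by (simp add: mult.commute)
  qed
  define B where "B = (\<chi> i j. if i \<notin> m \<and> j \<in> m then w i * cnj (p i $ j)
    else if i \<in> m \<and> j \<notin> m then - p j $ i * cnj (w j) else 0)"
  have B_skew: "B\<^sup>\<dagger> = - B"
    by (auto simp: vec_eq_iff B_def)
  have B_row: "B $ i $ j = w i * cnj (p i $ j)" and B_col: "B $ j $ i = - p i $ j * cnj (w i)"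
    if "i \<notin> m" for i j
    using that p_supp by (auto simp: B_def)
  have G_m: "i \<in> m \<longleftrightarrow> j \<in> m" if "G $ i $ j \<noteq> 0" for i j
    using component_eqI[OF that] by (metis component_eq_iff m_def)
  have B_m: "i \<in> m \<longleftrightarrow> j \<notin> m" if "B $ i $ j \<noteq> 0" for i j
    using that by (auto simp: B_def split: if_splits)
  have GB: "(G ** B) $ i $ i = 0" for i
    unfolding matrix_matrix_mult_def vec_lambda_beta
    using G_m[of i] B_m[of _ i] by (intro sum.neutral ballI) (metis mult_eq_0_iff)
  have BG: "(B ** G) $ i $ i = 0" for i
    unfolding matrix_matrix_mult_def vec_lambda_beta
    using G_m[of _ i] B_m[of i] by (intro sum.neutral ballI) (metis mult_eq_0_iff)
  have BGB: "(B ** G ** B) $ i $ i = - of_real (\<pi> i * (cmod (w i))\<^sup>2)" if i: "i \<notin> m" for i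
  proof -
    have "(G ** B) $ k $ i = - cnj (w i) * (of_real (\<pi> i) * p i $ k)" for k
      unfolding p_eig[symmetric] using i
      by (simp add: matrix_matrix_mult_def B_col sum_distrib_left mult_ac sum_negf)
    then have "(B ** (G ** B)) $ i $ i = - (w i * cnj (w i)) * of_real (\<pi> i) * (\<Sum>k\<in>UNIV. cnj (p i $ k) * p i $ k)"
      using i by (simp add: matrix_matrix_mult_def[of B] B_row sum_distrib_left mult_ac sum_negf)
    then show ?thesis
      unfolding p_unit by (simp add: mult_cnj_eq_cmod_square matrix_mul_assoc mult.commute)
  qed
  have GBB: "(G ** (B ** B)) $ i $ i = - of_real (\<theta> i * (cmod (w i))\<^sup>2)" if i: "i \<notin> m" for i
  proof -
    have "G $ i $ k * (B ** B) $ k $ i = - cnj (w i) * (G $ i $ k * w k)" for k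
    proof (cases "G $ i $ k = 0")
      case False
      then have "k \<notin> m" "p k = p i"
        using G_m i component_eqI[OF False] by (auto simp: p_def)
      then have "(B ** B) $ k $ i = - w k * cnj (w i) * (\<Sum>l\<in>UNIV. cnj (p i $ l) * p i $ l)"
        using i by (simp add: matrix_matrix_mult_def B_row B_col sum_distrib_left mult_ac sum_negf)
      then show ?thesis by (simp add: p_unit)
    qed simp
    then have "(G ** (B ** B)) $ i $ i = - cnj (w i) * (\<Sum>k\<in>UNIV. G $ i $ k * w k)"
      by (simp only: matrix_matrix_mult_def[of G] vec_lambda_beta sum_distrib_left)
    then show ?thesis
      unfolding w_eig using mult_cnj_eq_cmod_square[of "w i"] by (simp add: mult_ac)
  qed
  have BB_adj: "(B ** B)\<^sup>\<dagger> = B ** B"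
    by (simp add: conj_transpose_mult B_skew matrix_mult_bilinear)
  define R where "R = (1/2) *\<^sub>R (G ** (B ** B) + B ** B ** G) - B ** G ** B"
  have R_adj: "R\<^sup>\<dagger> = R"
    unfolding R_def
    by (simp only: conj_transpose_linear conj_transpose_mult B_skew G(1) BB_adj)
       (simp add: matrix_mult_bilinear matrix_mul_assoc add.commute)
  have R_diag: "Re (R $ i $ i) = (\<pi> i - \<theta> i) * (cmod (w i))\<^sup>2" if i: "i \<notin> m" for i
  proof -
    have "(B ** B ** G) = (G ** (B ** B))\<^sup>\<dagger>"
      by (subst conj_transpose_mult) (simp only: BB_adj G(1))
    then have "(B ** B ** G) $ i $ i = - of_real (\<theta> i * (cmod (w i))\<^sup>2)"
      using GBB[OF i] by simp
    then show ?thesis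
      using GBB[OF i] BGB[OF i] by (simp add: R_def algebra_simps)
  qed
  have R_trace: "trace R = 0"
  proof -
    have "trace (B ** G ** B) = trace (B ** B ** G)"
      by (subst trace_mul_sym) (simp add: matrix_mul_assoc)
    moreover have "trace (G ** (B ** B)) = trace (B ** B ** G)"
      by (rule trace_mul_sym)
    ultimately show ?thesis
      by (simp add: R_def trace_def sum_subtractf sum.distrib scaleR_add_right flip: scaleR_sum_right)
  qed
  define r where "r = (\<chi> i. - Re (H $ i $ i) - Re (R $ i $ i))"
  have r_total: "(\<Sum>i\<in>UNIV. r $ i) = 0"
    using arg_cong[OF H(2), of Re] arg_cong[OF R_trace, of Re]
    by (simp add: r_def trace_def sum_subtractf sum_negf)
  have r_component: "(\<Sum>k\<in>component G i. r $ k) = 0" if i: "component G i \<noteq> m" for i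
  proof -
    have "k \<notin> m" if "k \<in> component G i" for k
      using i that unfolding m_def by (metis component_eq_iff)
    then have "(\<Sum>k\<in>component G i. r $ k)
      = (\<Sum>k\<in>component G i. - Re (H $ k $ k) - (\<pi> k - \<theta> k) * (cmod (w k))\<^sup>2)"
      by (intro sum.cong refl) (simp add: r_def R_diag)
    also have "\<dots> = 0"
      using w_mass[of i] by (simp add: sum_subtractf \<sigma>_def sum_negf)
    finally show ?thesis .
  qed
  have orth: "k \<bullet> r = 0" if k: "compatible_weights G k" for k
  proof -
    \<comment> \<open>normalizing the weight to vanish on the hub removes the only component whose sum was not prescribed\<close>
    have "k \<bullet> r = (\<Sum>i\<in>UNIV. (k $ i - k $ a) * r $ i)"
      using r_total by (simp add: inner_vec_def algebra_simps sum_subtractf flip: sum_distrib_left)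
    also have "\<dots> = (\<Sum>c\<in>range (component G). \<Sum>i\<in>{i\<in>UNIV. component G i = c}. (k $ i - k $ a) * r $ i)"
      by (rule sum.image_gen) simp
    also have "\<dots> = 0"
    proof (rule sum.neutral, rule ballI)
      fix c assume "c \<in> range (component G)"
      then obtain j where j: "c = component G j" by auto
      have "component G i = c \<longleftrightarrow> i \<in> component G j" for i
        unfolding j by (subst eq_commute) (rule component_eq_iff)
      then have cj: "{i\<in>UNIV. component G i = c} = component G j"
        by simp
      have kj: "k $ i = k $ j" if "i \<in> component G j" for i
        by (rule compatible_weights_component[OF k], rule sym) (simp add: component_eq_iff that)
      show "(\<Sum>i\<in>{i\<in>UNIV. component G i = c}. (k $ i - k $ a) * r $ i) = 0"
      proof (cases "c = m")
        case True
        then have "k $ a = k $ j"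
          using j by (intro compatible_weights_component[OF k]) (simp add: m_def)
        then show ?thesis unfolding cj using kj by (intro sum.neutral ballI) simp
      next
        case False
        have "(\<Sum>i\<in>component G j. (k $ i - k $ a) * r $ i) = (k $ j - k $ a) * (\<Sum>i\<in>component G j. r $ i)"
          unfolding sum_distrib_left using kj by (intro sum.cong refl) simp
        then show ?thesis
          unfolding cj using False j r_component[of j] by simp
      qed
    qed
    finally show ?thesis .
  qed
  obtain N where N: "N\<^sup>\<dagger> = - N" "\<And>i. (G ** N - N ** G) $ i $ i = of_real (r $ i)"
    using commutator_diagonal_solvable[OF G(1) orth] by blast
  define P where "P = N + (1/2) *\<^sub>R (B ** B)"
  have P_adj: "P\<^sup>\<dagger> = - N + (1/2) *\<^sub>R (B ** B)"
    by (simp only: P_def conj_transpose_linear N(1) BB_adj)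
  show thesis
  proof (rule that[of B P])
    show "P + P\<^sup>\<dagger> = B ** B"
      unfolding P_adj by (simp add: P_def flip: scaleR_add_left)
    show "(G ** B - B ** G) $ i $ i = 0" for i
      by (simp add: GB BG)
    show "(H + P\<^sup>\<dagger> ** G + G ** P - B ** G ** B) $ i $ i = 0" for i
    proof -
      have "H + P\<^sup>\<dagger> ** G + G ** P - B ** G ** B = H + (G ** N - N ** G) + R"
        unfolding P_adj
        by (simp add: P_def R_def matrix_mult_bilinear scaleR_add_right)
      then have "(H + P\<^sup>\<dagger> ** G + G ** P - B ** G ** B) $ i $ i
          = H $ i $ i + (G ** N - N ** G) $ i $ i + R $ i $ i"
        by (simp only: vector_add_component)
      moreover have "H $ i $ i = of_real (Re (H $ i $ i))" "R $ i $ i = of_real (Re (R $ i $ i))"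
        by (rule self_adjoint_diagonal_real[OF H(1)]) (rule self_adjoint_diagonal_real[OF R_adj])
      ultimately show ?thesis
        unfolding N(2) by (simp add: r_def)
    qed
  qed (rule B_skew)
qed

section \<open>Singular value decompositions\<close>

text \<open>
  The positions at which the spectrum of a frame operator of \<open>k\<close> vectors may be non-zero.
\<close>

definition leading_indices :: "nat \<Rightarrow> 'd::{finite, linorder} set" where
  "leading_indices k = {j. card {..<j} < k}"

definition leading_indicator :: "nat \<Rightarrow> real^('d::{finite, linorder})" where
  "leading_indicator k = (\<chi> j. if j \<in> leading_indices k then 1 else 0)"

lemma card_leading_indices_le: "card (leading_indices k :: 'd::{finite, linorder} set) \<le> k"
proof -
  have "inj_on (\<lambda>j::'d. card {..<j}) (leading_indices k)"
    using bij_betw_card_lessThan by (auto simp: bij_betw_def intro: inj_on_subset)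
  then have "card (leading_indices k :: 'd set) \<le> card {..<k}"
    by (rule card_inj_on_le) (auto simp: leading_indices_def)
  then show ?thesis by simp
qed

lemma decreasing_leading_indicator: "decreasing (leading_indicator k)"
  unfolding decreasing_def leading_indicator_def leading_indices_def
  by (auto dest: card_lessThan_mono)

lemma decreasing_vanishes_off_leading_indices:
  fixes l :: "real^('d::{finite, linorder})"
  assumes "decreasing l" "card {j. 0 < l $ j} \<le> k" "j \<notin> leading_indices k"
  shows "l $ j \<le> 0"
proof (rule ccontr)
  assume "\<not> l $ j \<le> 0"
  then have "{..j} \<subseteq> {j. 0 < l $ j}"
    using assms(1) by (force simp: decreasing_def)
  then have "card {..j} \<le> k"
    using assms(2) card_mono[of "{j. 0 < l $ j}" "{..j}"] by simp
  moreover have "card {..<j} < card {..j}"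
    by (intro psubset_card_mono) auto
  ultimately show False
    using assms(3) by (simp add: leading_indices_def)
qed

lemma gram_leading_orthonormal:
  fixes A :: "complex^('d::{finite, linorder})^'n"
  assumes "orthonormal_on (leading_indices k) (\<lambda>j. column j A)"
    and "\<And>j. j \<notin> leading_indices k \<Longrightarrow> column j A = 0"
  shows "A\<^sup>\<dagger> ** A = real_diagonal (leading_indicator k)"
proof -
  have "cinner x 0 = 0" "cinner 0 x = 0" for x :: "complex^'n"
    by (simp_all add: cinner_def)
  then have "cinner (column i A) (column j A) = (if i = j \<and> j \<in> leading_indices k then 1 else 0)" for i j
    using assms unfolding orthonormal_on_def
    by (cases "i \<in> leading_indices k"; cases "j \<in> leading_indices k") auto
  then show ?thesis
    by (simp add: vec_eq_iff gram_nth real_diagonal_def leading_indicator_def)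
qed

text \<open>
  The rows of \<open>U\<^sup>\<dagger> Z\<close> are orthogonal with squared norms \<open>l\<close>. At most \<open>CARD('n)\<close> of them are non-zero, and
  being sorted they are at leading positions. Unlike in a reduced decomposition, \<open>A\<close> is filled up with
  orthonormal columns at all leading positions: the zero eigenvalues there are the ones that
  may become positive along the path to another spectrum.
\<close>

lemma singular_value_decomposition:
  fixes Z :: "complex^'n^('d::{finite, linorder})"
  defines "l \<equiv> eigenvalue_vector (Z ** Z\<^sup>\<dagger>)"
  obtains U :: "complex^('d::{finite, linorder})^('d::{finite, linorder})" and A :: "complex^('d::{finite, linorder})^'n"
  where "U\<^sup>\<dagger> ** U = mat 1" "A\<^sup>\<dagger> ** A = real_diagonal (leading_indicator CARD('n))"
    "Z = U ** real_diagonal (\<chi> j. sqrt (l $ j)) ** A\<^sup>\<dagger>" "decreasing l" "\<And>j. 0 \<le> l $ j"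
    "\<And>j. j \<notin> leading_indices CARD('n) \<Longrightarrow> l $ j = 0"
proof -
  let ?J = "leading_indices CARD('n) :: 'd set"
  have "(Z ** Z\<^sup>\<dagger>)\<^sup>\<dagger> = Z ** Z\<^sup>\<dagger>"
    by (simp add: conj_transpose_mult)
  then obtain U :: "complex^('d::{finite, linorder})^('d::{finite, linorder})"
    where U: "U\<^sup>\<dagger> ** U = mat 1" and ZZ: "Z ** Z\<^sup>\<dagger> = U ** real_diagonal l ** U\<^sup>\<dagger>" and dec: "decreasing l"
    unfolding l_def by (rule eigenvalue_vector_diagonalization)
  define Y where "Y = U\<^sup>\<dagger> ** Z"
  have "Y ** Y\<^sup>\<dagger> = U\<^sup>\<dagger> ** (Z ** Z\<^sup>\<dagger>) ** U"
    by (simp add: Y_def conj_transpose_mult matrix_mul_assoc)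
  also have "\<dots> = (U\<^sup>\<dagger> ** U) ** real_diagonal l ** (U\<^sup>\<dagger> ** U)"
    by (simp only: ZZ matrix_mul_assoc)
  finally have YY: "Y ** Y\<^sup>\<dagger> = real_diagonal l"
    by (simp add: U)
  have rows: "(\<Sum>i\<in>UNIV. Y $ j $ i * cnj (Y $ k $ i)) = (if j = k then of_real (l $ j) else 0)" for j k
    using arg_cong[OF YY, of "\<lambda>M. M $ j $ k"] by (simp add: matrix_matrix_mult_def real_diagonal_def)
  have row_norm: "(\<Sum>i\<in>UNIV. (cmod (Y $ j $ i))\<^sup>2) = l $ j" for j
  proof -
    have "complex_of_real (\<Sum>i\<in>UNIV. (cmod (Y $ j $ i))\<^sup>2) = of_real (l $ j)"
      using rows[of j j] by (simp only: of_real_sum mult_cnj_eq_cmod_square refl if_True)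
    then show ?thesis by (simp only: of_real_eq_iff)
  qed
  have nonneg: "0 \<le> l $ j" for j
    by (simp add: sum_nonneg flip: row_norm)
  define a where "a j = (\<chi> i. cnj (Y $ j $ i) / of_real (sqrt (l $ j)))" for j
  have a: "orthonormal_on {j. 0 < l $ j} a"
    unfolding orthonormal_on_def
  proof (intro ballI)
    fix j k assume "j \<in> {j. 0 < l $ j}" "k \<in> {j. 0 < l $ j}"
    then have pos: "0 < l $ j" "0 < l $ k" by auto
    have "cinner (a j) (a k) = (\<Sum>i\<in>UNIV. Y $ j $ i * cnj (Y $ k $ i)) / (of_real (sqrt (l $ j)) * of_real (sqrt (l $ k)))"
      by (simp add: cinner_def a_def sum_divide_distrib)
    then show "cinner (a j) (a k) = (if j = k then 1 else 0)"
      using pos by (simp add: rows flip: of_real_mult)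
  qed
  then have "card {j. 0 < l $ j} \<le> CARD('n)"
    by (intro orthonormal_on_card_le) auto
  then have vanish: "l $ j = 0" if "j \<notin> ?J" for j
    using decreasing_vanishes_off_leading_indices[OF dec _ that] nonneg[of j] by simp
  then have "{j. 0 < l $ j} \<subseteq> ?J"
    using less_irrefl by fastforce
  then obtain b where b: "orthonormal_on ?J b" "\<forall>j\<in>{j. 0 < l $ j}. b j = a j"
    using orthonormal_on_extend[OF a] card_leading_indices_le[of "CARD('n)"] by (metis finite)
  define A where "A = matrix_of_columns (\<lambda>j. if j \<in> ?J then b j else 0)"
  have A: "A\<^sup>\<dagger> ** A = real_diagonal (leading_indicator CARD('n))"
    using b(1) by (intro gram_leading_orthonormal) (simp_all add: A_def orthonormal_on_def)
  have "real_diagonal (\<chi> j. sqrt (l $ j)) ** A\<^sup>\<dagger> = Y"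
  proof -
    have "of_real (sqrt (l $ j)) * cnj (A $ i $ j) = Y $ j $ i" for i j
    proof (cases "0 < l $ j")
      case True
      then have "j \<in> ?J" using vanish by force
      then show ?thesis
        using True b(2) by (simp add: A_def matrix_of_columns_def a_def)
    next
      case False
      then have "l $ j = 0" using nonneg[of j] by simp
      then have "Y $ j $ i = 0"
        using row_norm[of j] by (simp add: sum_nonneg_eq_0_iff)
      then show ?thesis using \<open>l $ j = 0\<close> by simp
    qed
    then show ?thesis
      by (simp add: vec_eq_iff real_diagonal_mult_nth)
  qed
  moreover have "Z = U ** Y"
    by (simp add: Y_def matrix_mul_assoc unitary_right_inverse[OF U])
  ultimately have "Z = U ** real_diagonal (\<chi> j. sqrt (l $ j)) ** A\<^sup>\<dagger>"
    by (metis matrix_mul_assoc)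
  then show thesis
    using that[OF U A] dec nonneg vanish by blast
qed

lemma trace_unitary_diagonal:
  fixes U :: "complex^'k^'n"
  shows "trace (U ** real_diagonal l ** U\<^sup>\<dagger>) = trace (real_diagonal l ** (U\<^sup>\<dagger> ** U))"
  by (subst trace_mul_sym) (metis matrix_mul_assoc trace_mul_sym)

lemma trace_real_diagonal: "trace (real_diagonal l) = of_real (\<Sum>j\<in>UNIV. l $ j)"
  by (simp add: trace_def real_diagonal_def)

lemma unit_column_matrices_gram:
  "Z \<in> unit_column_matrices \<longleftrightarrow> (\<forall>j. (Z\<^sup>\<dagger> ** Z) $ j $ j = 1)"
proof -
  have "(norm (column j Z) = 1) \<longleftrightarrow> (complex_of_real ((norm (column j Z))\<^sup>2) = 1)" for j
    using power2_eq_1_iff[of "norm (column j Z)"] norm_ge_zero[of "column j Z"]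
    unfolding of_real_eq_1_iff by auto
  then show ?thesis
    by (simp add: unit_column_matrices_def gram_nth cinner_self)
qed

lemma sum_eigenvalue_vector_frame:
  fixes Z :: "complex^'n^('d::{finite, linorder})"
  assumes "Z \<in> unit_column_matrices"
  shows "(\<Sum>j\<in>UNIV. eigenvalue_vector (Z ** Z\<^sup>\<dagger>) $ j) = real CARD('n)"
proof -
  let ?l = "eigenvalue_vector (Z ** Z\<^sup>\<dagger>)"
  have "(Z ** Z\<^sup>\<dagger>)\<^sup>\<dagger> = Z ** Z\<^sup>\<dagger>"
    by (simp add: conj_transpose_mult)
  then obtain U :: "complex^('d::{finite, linorder})^('d::{finite, linorder})"
    where U: "U\<^sup>\<dagger> ** U = mat 1" "Z ** Z\<^sup>\<dagger> = U ** real_diagonal ?l ** U\<^sup>\<dagger>"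
    by (rule eigenvalue_vector_diagonalization)
  have "complex_of_real (\<Sum>j\<in>UNIV. ?l $ j) = trace (Z ** Z\<^sup>\<dagger>)"
    by (subst U(2)) (simp add: trace_unitary_diagonal U(1) trace_real_diagonal)
  also have "\<dots> = trace (Z\<^sup>\<dagger> ** Z)"
    by (rule trace_mul_sym)
  also have "\<dots> = of_nat CARD('n)"
    using assms by (simp add: unit_column_matrices_gram trace_def)
  finally show ?thesis
    by (metis of_real_eq_iff of_real_of_nat_eq)
qed

section \<open>A flat decomposition of an isometry\<close>

lemma sum_powers_roots_unity:
  assumes "a < n" "b < n"
  defines "\<zeta> \<equiv> \<lambda>k. cis (2 * pi * real k / real n)"
  shows "(\<Sum>r<n. (cnj (\<zeta> a) * \<zeta> b) ^ r) = (if a = b then of_nat n else 0)"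
proof (cases "a = b")
  case True
  then show ?thesis by (simp add: \<zeta>_def flip: cis_cnj) (simp add: cis_cnj cis_mult)
next
  case False
  have bij: "bij_betw \<zeta> {..<n} {z. z ^ n = 1}"
    unfolding \<zeta>_def by (rule Complex.bij_betw_roots_unity) (use assms(1) in simp)
  let ?z = "cnj (\<zeta> a) * \<zeta> b"
  have unity: "\<zeta> a ^ n = 1" "\<zeta> b ^ n = 1"
    using bij assms by (auto simp: bij_betw_def)
  then have "?z ^ n = 1"
    by (simp add: power_mult_distrib flip: complex_cnj_power)
  moreover have "?z \<noteq> 1"
  proof
    assume "?z = 1"
    then have "\<zeta> a * (cnj (\<zeta> a) * \<zeta> b) = \<zeta> a" by simp
    moreover have "\<zeta> a * cnj (\<zeta> a) = 1"
      by (simp add: \<zeta>_def mult_cnj_eq_cmod_square)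
    ultimately have "\<zeta> b = \<zeta> a"
      by (metis mult.assoc mult_1)
    then show False
      using False bij assms(1,2) by (auto simp: bij_betw_def inj_on_def)
  qed
  ultimately show ?thesis
    using False by (simp add: geometric_sum)
qed

text \<open>
  If the columns of \<open>Z\<close> are orthonormal, then every orthonormal basis consists of right singular vectors.
  The discrete Fourier basis has entries of constant modulus, so that any change of the singular
  values that preserves their square sum preserves the column norms as well.
\<close>

lemma isometry_flat_decomposition:
  fixes Z :: "complex^'n^('d::{finite, linorder})"
  assumes Z: "Z\<^sup>\<dagger> ** Z = mat 1"
  defines "l \<equiv> eigenvalue_vector (Z ** Z\<^sup>\<dagger>)"
  obtains U :: "complex^('d::{finite, linorder})^('d::{finite, linorder})" and A :: "complex^('d::{finite, linorder})^'n"
  where "U\<^sup>\<dagger> ** U = mat 1" "A\<^sup>\<dagger> ** A = real_diagonal (leading_indicator CARD('n))"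
    "Z = U ** real_diagonal (\<chi> j. sqrt (l $ j)) ** A\<^sup>\<dagger>"
    "\<And>i j. j \<in> leading_indices CARD('n) \<Longrightarrow> A $ i $ j * cnj (A $ i $ j) = 1 / of_nat CARD('n)"
proof -
  let ?n = "CARD('n)"
  let ?J = "leading_indices ?n :: 'd set"
  define \<zeta> where "\<zeta> k = cis (2 * pi * real k / real ?n)" for k
  define \<kappa> where "\<kappa> j = card {..<j}" for j :: 'd
  obtain \<sigma> :: "'n \<Rightarrow> nat" where \<sigma>: "bij_betw \<sigma> UNIV {..<?n}"
    using ex_bij_betw_finite_nat[of "UNIV :: 'n set"] by (auto simp: atLeast0LessThan)
  have \<sigma>_less: "\<sigma> i < ?n" for i
    using \<sigma> by (auto simp: bij_betw_def)
  have "orthonormal_on UNIV (\<lambda>i. column i Z)"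
    unfolding orthonormal_on_def by (simp add: mat_def Z flip: gram_nth)
  then have "?n \<le> CARD('d)"
    using orthonormal_on_card_le by (metis finite)
  then have \<kappa>: "bij_betw \<kappa> ?J {..<?n}"
    using bij_betw_card_lessThan[where 'd = 'd] unfolding \<kappa>_def[abs_def]
    by (auto simp: bij_betw_def leading_indices_def intro: inj_on_subset)
  define A :: "complex^('d::{finite, linorder})^'n" where
    "A = (\<chi> i j. if j \<in> ?J then \<zeta> (\<kappa> j) ^ \<sigma> i / of_real (sqrt (real ?n)) else 0)"
  have sqrt_n: "complex_of_real (sqrt (real ?n)) * complex_of_real (sqrt (real ?n)) = of_nat ?n"
    by (simp flip: of_real_mult)
  have \<kappa>_less: "\<kappa> j < ?n" if "j \<in> ?J" for j
    using that by (simp add: \<kappa>_def leading_indices_def)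
  have A: "A\<^sup>\<dagger> ** A = real_diagonal (leading_indicator ?n)"
  proof -
    have "cinner (column j A) (column k A) = (if j = k then 1 else 0)" if jk: "j \<in> ?J" "k \<in> ?J" for j k
    proof -
      have "cinner (column j A) (column k A) = (\<Sum>i\<in>UNIV. (cnj (\<zeta> (\<kappa> j)) * \<zeta> (\<kappa> k)) ^ \<sigma> i) / of_nat ?n"
        using jk by (simp add: cinner_def column_def A_def sqrt_n power_mult_distrib sum_divide_distrib)
      also have "(\<Sum>i\<in>UNIV. (cnj (\<zeta> (\<kappa> j)) * \<zeta> (\<kappa> k)) ^ \<sigma> i) = (\<Sum>r<?n. (cnj (\<zeta> (\<kappa> j)) * \<zeta> (\<kappa> k)) ^ r)"
        by (rule sum.reindex_bij_betw[OF \<sigma>])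
      also have "\<dots> = (if \<kappa> j = \<kappa> k then of_nat ?n else 0)"
        unfolding \<zeta>_def using jk by (intro sum_powers_roots_unity \<kappa>_less)
      also have "\<kappa> j = \<kappa> k \<longleftrightarrow> j = k"
        using \<kappa> jk by (auto simp: bij_betw_def inj_on_def)
      finally show ?thesis by simp
    qed
    moreover have "column j A = 0" if "j \<notin> ?J" for j
      using that by (simp add: column_def A_def vec_eq_iff)
    ultimately show ?thesis
      by (intro gram_leading_orthonormal) (simp_all add: orthonormal_on_def)
  qed
  have AA: "A ** A\<^sup>\<dagger> = mat 1"
  proof -
    have "(A ** A\<^sup>\<dagger>) $ i $ k = (if i = k then 1 else 0)" for i k
    proof -
      have pow: "\<zeta> a ^ b = \<zeta> b ^ a" for a b
        by (simp add: \<zeta>_def Complex.DeMoivre mult_ac)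
      have "(A ** A\<^sup>\<dagger>) $ i $ k = (\<Sum>j\<in>?J. (A $ i $ j) * cnj (A $ k $ j))"
        unfolding matrix_matrix_mult_def vec_lambda_beta conj_transpose_nth
        by (rule sum.mono_neutral_right) (auto simp: A_def)
      also have "\<dots> = (\<Sum>j\<in>?J. (cnj (\<zeta> (\<sigma> k)) * \<zeta> (\<sigma> i)) ^ \<kappa> j) / of_nat ?n"
        by (simp add: A_def sqrt_n power_mult_distrib sum_divide_distrib mult.commute pow[of "\<kappa> _"] flip: complex_cnj_power)
      also have "(\<Sum>j\<in>?J. (cnj (\<zeta> (\<sigma> k)) * \<zeta> (\<sigma> i)) ^ \<kappa> j) = (\<Sum>r<?n. (cnj (\<zeta> (\<sigma> k)) * \<zeta> (\<sigma> i)) ^ r)"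
        by (rule sum.reindex_bij_betw[OF \<kappa>])
      also have "\<dots> = (if \<sigma> k = \<sigma> i then of_nat ?n else 0)"
        unfolding \<zeta>_def by (intro sum_powers_roots_unity \<sigma>_less)
      also have "\<sigma> k = \<sigma> i \<longleftrightarrow> i = k"
        using \<sigma> by (auto simp: bij_betw_def inj_on_def)
      finally show ?thesis by simp
    qed
    then show ?thesis by (simp add: vec_eq_iff mat_def)
  qed
  have "(Z ** A)\<^sup>\<dagger> ** (Z ** A) = A\<^sup>\<dagger> ** (Z\<^sup>\<dagger> ** Z) ** A"
    by (simp add: conj_transpose_mult matrix_mul_assoc)
  then have ZA: "(Z ** A)\<^sup>\<dagger> ** (Z ** A) = real_diagonal (leading_indicator ?n)"
    by (simp add: Z A)
  have "orthonormal_on ?J (\<lambda>j. column j (Z ** A))"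
    unfolding orthonormal_on_def by (simp add: ZA real_diagonal_def leading_indicator_def flip: gram_nth)
  then obtain u where u: "orthonormal_on UNIV u" "\<forall>j\<in>?J. u j = column j (Z ** A)"
    using orthonormal_on_extend[of ?J "\<lambda>j. column j (Z ** A)" UNIV] by auto
  define U where "U = matrix_of_columns u"
  have U: "U\<^sup>\<dagger> ** U = mat 1"
    unfolding U_def by (rule orthonormal_on_UNIV_imp_unitary[OF u(1)])
  have "(U ** real_diagonal (leading_indicator ?n)) $ i $ j = (Z ** A) $ i $ j" for i j
  proof (cases "j \<in> ?J")
    case True
    then show ?thesis
      using u(2) by (simp add: mult_real_diagonal_nth leading_indicator_def U_def matrix_of_columns_def column_def)
  next
    case False
    then show ?thesis
      by (simp add: mult_real_diagonal_nth leading_indicator_def) (simp add: matrix_matrix_mult_def A_def)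
  qed
  then have UD: "U ** real_diagonal (leading_indicator ?n) = Z ** A"
    by (simp add: vec_eq_iff)
  then have Z_eq: "Z = U ** real_diagonal (leading_indicator ?n) ** A\<^sup>\<dagger>"
    by (simp add: AA flip: matrix_mul_assoc)
  have idem: "real_diagonal (leading_indicator ?n) ** real_diagonal (leading_indicator ?n)
      = real_diagonal (leading_indicator ?n :: real^('d::{finite, linorder}))"
    by (simp add: real_diagonal_mult) (simp add: leading_indicator_def if_distrib cong: if_cong)
  have "Z ** Z\<^sup>\<dagger> = (Z ** A) ** (Z ** A)\<^sup>\<dagger>"
    by (simp add: conj_transpose_mult AA flip: matrix_mul_assoc) (simp add: AA matrix_mul_assoc)
  also have "\<dots> = U ** (real_diagonal (leading_indicator ?n) ** real_diagonal (leading_indicator ?n)) ** U\<^sup>\<dagger>"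
    by (simp add: conj_transpose_mult matrix_mul_assoc flip: UD)
  finally have "Z ** Z\<^sup>\<dagger> = U ** real_diagonal (leading_indicator ?n) ** U\<^sup>\<dagger>"
    by (simp only: idem)
  then have "l = leading_indicator ?n"
    by (simp add: l_def eigenvalue_vector_unitary_diagonal[OF U decreasing_leading_indicator])
  then have "(\<chi> j. sqrt (l $ j)) = (leading_indicator ?n :: real^('d::{finite, linorder}))"
    by (simp add: leading_indicator_def vec_eq_iff)
  with Z_eq have "Z = U ** real_diagonal (\<chi> j. sqrt (l $ j)) ** A\<^sup>\<dagger>"
    by simp
  moreover have "A $ i $ j * cnj (A $ i $ j) = 1 / of_nat ?n" if "j \<in> ?J" for i j
    using that by (simp add: A_def sqrt_n mult_cnj_eq_cmod_square \<zeta>_def norm_power flip: power_mult_distrib)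
  ultimately show thesis
    using that[OF U A] by blast
qed

section \<open>Moving the spectrum along a segment\<close>

text \<open>
  The path is \<open>M\<^sub>s Q\<^sub>s\<close> with normalized columns, where \<open>M\<^sub>s\<close> has the squared singular values
  \<open>L\<^sub>s = l + s\<^sup>2 (m - l)\<close> and \<open>Q\<^sub>s = 1 + s B + s\<^sup>2 P\<close>. The frame operator of \<open>M\<^sub>s\<close> has exactly the
  eigenvalue vector \<open>L\<^sub>s\<close>, which is sorted because \<open>l\<close> and \<open>m\<close> are. Since \<open>Q\<^sub>s Q\<^sub>s\<^sup>\<dagger> = 1 + O(s\<^sup>3)\<close> and the diagonal conditions
  make the squared column norms \<open>1 + O(s\<^sup>3)\<close>, neither \<open>Q\<^sub>s\<close> nor the normalization changes the frame
  operator by more than \<open>O(s\<^sup>3)\<close>, and Weyl's inequality applies. The parameter is \<open>s = \<surd>t\<close> for the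
  position \<open>t\<close> on the segment because the transfer between components is a second-order effect.
\<close>

lemma frame_path:
  fixes Z :: "complex^'n^('d::{finite, linorder})"
    and U :: "complex^('d::{finite, linorder})^('d::{finite, linorder})"
    and A :: "complex^('d::{finite, linorder})^'n"
  assumes Z: "Z \<in> unit_column_matrices"
    and U: "U\<^sup>\<dagger> ** U = mat 1" and A: "A\<^sup>\<dagger> ** A = real_diagonal (leading_indicator k)"
    and Z_eq: "Z = U ** real_diagonal (\<chi> j. sqrt (l $ j)) ** A\<^sup>\<dagger>"
    and dec: "decreasing l" "decreasing m" and nonneg: "\<And>j. 0 \<le> l $ j" "\<And>j. 0 \<le> m $ j"
    and vanish: "\<And>j. j \<notin> leading_indices k \<Longrightarrow> l $ j = 0" "\<And>j. j \<notin> leading_indices k \<Longrightarrow> m $ j = 0"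
    and B: "B\<^sup>\<dagger> = - B" and P: "P + P\<^sup>\<dagger> = B ** B"
  defines "G \<equiv> Z\<^sup>\<dagger> ** Z" and "H \<equiv> A ** real_diagonal (m - l) ** A\<^sup>\<dagger>"
  assumes diag1: "\<And>i. (G ** B - B ** G) $ i $ i = 0"
    and diag2: "\<And>i. (H + P\<^sup>\<dagger> ** G + G ** P - B ** G ** B) $ i $ i = 0"
  obtains Zs where "\<forall>\<^sub>F s in at_right 0. Zs s \<in> unit_column_matrices" "(Zs \<longlongrightarrow> Z) (at_right 0)"
    "((\<lambda>s. (eigenvalue_vector (Zs s ** (Zs s)\<^sup>\<dagger>) - l) /\<^sub>R s\<^sup>2) \<longlongrightarrow> m - l) (at_right (0::real))"
proof -
  define L where "L s = l + s\<^sup>2 *\<^sub>R (m - l)" for s :: real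
  define q where "q s = (\<chi> j. sqrt (L s $ j))" for s
  define M where "M s = U ** real_diagonal (q s) ** A\<^sup>\<dagger>" for s
  define Q where "Q s = mat 1 + s *\<^sub>R B + s\<^sup>2 *\<^sub>R P" for s :: real
  define Y where "Y s = M s ** Q s" for s
  \<comment> \<open>the coefficients of \<open>s\<^sup>3, \<dots>, s\<^sup>6\<close> in \<open>Q\<^sub>s\<^sup>\<dagger> (G + s\<^sup>2 H) Q\<^sub>s\<close>, with \<open>s\<^sup>3\<close> taken out\<close>
  define E where "E s = (H ** B - B ** (G ** P) - B ** H + P\<^sup>\<dagger> ** (G ** B))
    + s *\<^sub>R (H ** P - B ** (H ** B) + P\<^sup>\<dagger> ** (G ** P) + P\<^sup>\<dagger> ** H)
    + s\<^sup>2 *\<^sub>R (P\<^sup>\<dagger> ** (H ** B) - B ** (H ** P)) + s^3 *\<^sub>R (P\<^sup>\<dagger> ** (H ** P))" for s :: real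
  define F where "F s = B ** P\<^sup>\<dagger> - P ** B + s *\<^sub>R (P ** P\<^sup>\<dagger>)" for s :: real
  define \<epsilon> where "\<epsilon> s = (\<chi> j. Re (E s $ j $ j))" for s
  define c where "c s j = norm (column j (Y s))" for s j
  define Zs where "Zs s = Y s ** real_diagonal (\<chi> j. 1 / c s j)" for s
  \<comment> \<open>the deviation of the frame operator from the one with spectrum \<open>L s\<close>, with \<open>s\<^sup>3\<close> taken out\<close>
  define X where "X s = M s ** F s ** (M s)\<^sup>\<dagger> - Y s ** real_diagonal (\<chi> j. \<epsilon> s $ j / (c s j)\<^sup>2) ** (Y s)\<^sup>\<dagger>" for s

  have s0: "((\<lambda>s::real. s) \<longlongrightarrow> 0) (at_right 0)"
    by (rule tendsto_ident_at)
  have small: "\<forall>\<^sub>F s in at_right (0::real). 0 < s \<and> s < 1"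
    by (rule eventually_at_rightI[of 0 1]) auto

  have L_nth: "L s $ j = (1 - s\<^sup>2) * l $ j + s\<^sup>2 * m $ j" for s j
    by (simp add: L_def algebra_simps)
  have L: "decreasing (L s)" "0 \<le> L s $ j" if "0 < s" "s < 1" for s j
  proof -
    have "s\<^sup>2 \<le> 1" using that by (simp add: power_le_one)
    then show "0 \<le> L s $ j" "decreasing (L s)"
      using nonneg dec by (auto simp: decreasing_def L_nth intro!: add_mono mult_left_mono)
  qed
  have L_vanish: "L s $ j = 0" if "j \<notin> leading_indices k" for s j
    using vanish that by (simp add: L_nth)

  have MM: "M s ** (M s)\<^sup>\<dagger> = U ** real_diagonal (L s) ** U\<^sup>\<dagger>"
    and M_gram: "(M s)\<^sup>\<dagger> ** M s = G + s\<^sup>2 *\<^sub>R H" if s: "0 < s" "s < 1" for s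
  proof -
    have "M s ** (M s)\<^sup>\<dagger> = U ** (real_diagonal (q s) ** (A\<^sup>\<dagger> ** A) ** real_diagonal (q s)) ** U\<^sup>\<dagger>"
      by (simp add: M_def conj_transpose_mult matrix_mul_assoc)
    also have "real_diagonal (q s) ** (A\<^sup>\<dagger> ** A) ** real_diagonal (q s) = real_diagonal (L s)"
      unfolding A real_diagonal_mult
      using L(2)[OF s] L_vanish by (intro arg_cong[of _ _ real_diagonal]) (simp add: q_def leading_indicator_def vec_eq_iff)
    finally show "M s ** (M s)\<^sup>\<dagger> = U ** real_diagonal (L s) ** U\<^sup>\<dagger>" .
    have "(M s)\<^sup>\<dagger> ** M s = A ** (real_diagonal (q s) ** (U\<^sup>\<dagger> ** U) ** real_diagonal (q s)) ** A\<^sup>\<dagger>"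
      by (simp add: M_def conj_transpose_mult matrix_mul_assoc)
    also have "real_diagonal (q s) ** (U\<^sup>\<dagger> ** U) ** real_diagonal (q s) = real_diagonal (L s)"
      unfolding U matrix_mul_rid real_diagonal_mult
      using L(2)[OF s] by (intro arg_cong[of _ _ real_diagonal]) (simp add: q_def vec_eq_iff)
    also have "A ** real_diagonal (L s) ** A\<^sup>\<dagger> = A ** real_diagonal l ** A\<^sup>\<dagger> + s\<^sup>2 *\<^sub>R H"
      by (simp only: L_def H_def real_diagonal_linear matrix_mult_bilinear)
    also have "A ** real_diagonal l ** A\<^sup>\<dagger> = G"
    proof -
      have "G = A ** (real_diagonal (\<chi> j. sqrt (l $ j)) ** (U\<^sup>\<dagger> ** U) ** real_diagonal (\<chi> j. sqrt (l $ j))) ** A\<^sup>\<dagger>"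
        by (simp add: G_def Z_eq conj_transpose_mult matrix_mul_assoc)
      also have "real_diagonal (\<chi> j. sqrt (l $ j)) ** (U\<^sup>\<dagger> ** U) ** real_diagonal (\<chi> j. sqrt (l $ j)) = real_diagonal l"
        unfolding U matrix_mul_rid real_diagonal_mult
        using nonneg(1) by (intro arg_cong[of _ _ real_diagonal]) (simp add: vec_eq_iff)
      finally show ?thesis by simp
    qed
    finally show "(M s)\<^sup>\<dagger> ** M s = G + s\<^sup>2 *\<^sub>R H" .
  qed

  have Q_adj: "(Q s)\<^sup>\<dagger> = mat 1 - s *\<^sub>R B + s\<^sup>2 *\<^sub>R P\<^sup>\<dagger>" for s
    by (simp add: Q_def conj_transpose_linear B)
  have QQ: "Q s ** (Q s)\<^sup>\<dagger> = mat 1 + s^3 *\<^sub>R F s" for s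
  proof -
    have "Q s ** (Q s)\<^sup>\<dagger> = mat 1 + s\<^sup>2 *\<^sub>R (P + P\<^sup>\<dagger> - B ** B) + s^3 *\<^sub>R F s"
      unfolding Q_adj
      by (simp add: Q_def F_def matrix_mult_bilinear scaleR_add_right scaleR_diff_right
          power2_eq_square power3_eq_cube mult_ac algebra_simps)
    then show ?thesis by (simp add: P)
  qed
  have Y_gram: "(Y s)\<^sup>\<dagger> ** Y s = G + s *\<^sub>R (G ** B - B ** G)
      + s\<^sup>2 *\<^sub>R (H + P\<^sup>\<dagger> ** G + G ** P - B ** G ** B) + s^3 *\<^sub>R E s" if "0 < s" "s < 1" for s
  proof -
    have "(Y s)\<^sup>\<dagger> ** Y s = (Q s)\<^sup>\<dagger> ** (((M s)\<^sup>\<dagger> ** M s) ** Q s)"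
      by (simp add: Y_def conj_transpose_mult matrix_mul_assoc)
    also have "\<dots> = (mat 1 - s *\<^sub>R B + s\<^sup>2 *\<^sub>R P\<^sup>\<dagger>) ** ((G + s\<^sup>2 *\<^sub>R H) ** (mat 1 + s *\<^sub>R B + s\<^sup>2 *\<^sub>R P))"
      by (simp only: Q_adj M_gram[OF that]) (simp only: Q_def)
    also have "\<dots> = G + s *\<^sub>R (G ** B - B ** G)
      + s\<^sup>2 *\<^sub>R (H + P\<^sup>\<dagger> ** G + G ** P - B ** (G ** B)) + s^3 *\<^sub>R E s"
      by (simp add: E_def matrix_mult_bilinear scaleR_add_right scaleR_diff_right
          power2_eq_square power3_eq_cube mult_ac algebra_simps)
    finally show ?thesis by (simp only: matrix_mul_assoc)
  qed
  have G_diag: "G $ j $ j = 1" for j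
    using Z by (simp add: unit_column_matrices_gram G_def)
  have c_square: "(c s j)\<^sup>2 = 1 + s^3 * \<epsilon> s $ j" if "0 < s" "s < 1" for s j
  proof -
    have "complex_of_real ((c s j)\<^sup>2) = ((Y s)\<^sup>\<dagger> ** Y s) $ j $ j"
      by (simp only: gram_nth cinner_self c_def)
    also have "\<dots> = 1 + s^3 *\<^sub>R (E s $ j $ j)"
      unfolding Y_gram[OF that] using diag1[of j] diag2[of j] G_diag[of j]
      by (simp only: vector_add_component vector_scaleR_component) simp
    finally have "Re (complex_of_real ((c s j)\<^sup>2)) = Re (1 + s^3 *\<^sub>R (E s $ j $ j))"
      by (rule arg_cong)
    then show ?thesis by (simp add: \<epsilon>_def del: of_real_power)
  qed

  have q_lim: "(q \<longlongrightarrow> (\<chi> j. sqrt (l $ j))) (at_right 0)"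
  proof -
    have "((\<lambda>s. \<chi> j. sqrt (L s $ j)) \<longlongrightarrow> (\<chi> j. sqrt ((l + 0\<^sup>2 *\<^sub>R (m - l)) $ j))) (at_right 0)"
      unfolding L_def by (intro tendsto_intros s0)
    then show ?thesis by (simp add: q_def[abs_def])
  qed
  have M_lim: "(M \<longlongrightarrow> Z) (at_right 0)"
    unfolding M_def[abs_def] Z_eq by (intro tendsto_intros q_lim)
  have Y_lim: "(Y \<longlongrightarrow> Z) (at_right 0)"
  proof -
    have "(Y \<longlongrightarrow> Z ** (mat 1 + 0 *\<^sub>R B + 0\<^sup>2 *\<^sub>R P)) (at_right 0)"
      unfolding Y_def[abs_def] Q_def by (intro tendsto_intros M_lim s0)
    then show ?thesis by simp
  qed
  have c_lim: "((\<lambda>s. c s j) \<longlongrightarrow> 1) (at_right 0)" for j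
  proof -
    have "((\<lambda>s. c s j) \<longlongrightarrow> norm (column j Z)) (at_right 0)"
      unfolding c_def column_def by (intro tendsto_intros Y_lim)
    then show ?thesis using Z by (simp add: unit_column_matrices_def)
  qed
  have Zs_lim: "(Zs \<longlongrightarrow> Z) (at_right 0)"
  proof -
    have "(Zs \<longlongrightarrow> Z ** real_diagonal (\<chi> j. 1 / 1)) (at_right 0)"
      unfolding Zs_def[abs_def] by (intro tendsto_intros Y_lim c_lim) auto
    moreover have "real_diagonal (\<chi> j. 1 / 1) = (mat 1 :: complex^'n^'n)"
      by (simp add: real_diagonal_def mat_def vec_eq_iff)
    ultimately show ?thesis by simp
  qed
  have E_lim: "(E \<longlongrightarrow> E 0) (at_right 0)"
    unfolding E_def[abs_def] by (intro tendsto_intros s0)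
  have F_lim: "(F \<longlongrightarrow> F 0) (at_right 0)"
    unfolding F_def[abs_def] by (intro tendsto_intros s0)
  obtain X0 where X_lim: "(X \<longlongrightarrow> X0) (at_right 0)"
  proof
    show "(X \<longlongrightarrow> Z ** F 0 ** Z\<^sup>\<dagger> - Z ** real_diagonal (\<chi> j. Re (E 0 $ j $ j) / 1\<^sup>2) ** Z\<^sup>\<dagger>) (at_right 0)"
      unfolding X_def[abs_def] \<epsilon>_def vec_lambda_beta
      by (intro tendsto_intros M_lim Y_lim c_lim E_lim F_lim) auto
  qed

  have "\<forall>\<^sub>F s in at_right 0. \<forall>j. 0 < c s j"
    by (intro eventually_all_finite order_tendstoD(1)[OF c_lim]) simp
  with small have good: "\<forall>\<^sub>F s in at_right 0. 0 < s \<and> s < 1 \<and> (\<forall>j. 0 < c s j)"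
    by eventually_elim simp
  have unit: "\<forall>\<^sub>F s in at_right 0. Zs s \<in> unit_column_matrices"
    using good
  proof eventually_elim
    case (elim s)
    have "column j (Zs s) = (1 / c s j) *\<^sub>R column j (Y s)" for j
      by (simp add: column_def Zs_def vec_eq_iff mult_real_diagonal_nth) (simp add: scaleR_conv_of_real)
    moreover have "c s j \<noteq> 0" for j
      using elim by (metis less_irrefl)
    ultimately show ?case
      by (simp add: unit_column_matrices_def) (simp add: c_def)
  qed
  obtain K where K: "\<And>(A :: complex^('d::{finite, linorder})^('d::{finite, linorder})) B i. A\<^sup>\<dagger> = A \<Longrightarrow> B\<^sup>\<dagger> = B \<Longrightarrow>
      \<bar>eigenvalue_vector A $ i - eigenvalue_vector B $ i\<bar> \<le> norm (A - B) * K"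
    by (rule weyl_inequality) blast
  define W where "W s = (eigenvalue_vector (Zs s ** (Zs s)\<^sup>\<dagger>) - l) /\<^sub>R s\<^sup>2" for s
  have bound: "\<forall>\<^sub>F s in at_right 0. \<forall>j. \<bar>W s $ j - (m - l) $ j\<bar> \<le> s * norm (X s) * K"
    using good
  proof eventually_elim
    case (elim s)
    then have s: "0 < s" "s < 1" and c: "\<And>j. c s j \<noteq> 0" by (auto simp: less_imp_neq[THEN not_sym])
    let ?S = "Zs s ** (Zs s)\<^sup>\<dagger>" and ?T = "U ** real_diagonal (L s) ** U\<^sup>\<dagger>"
    have "?S = Y s ** (real_diagonal (\<chi> j. 1 / c s j) ** real_diagonal (\<chi> j. 1 / c s j)) ** (Y s)\<^sup>\<dagger>"
      by (simp add: Zs_def conj_transpose_mult matrix_mul_assoc)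
    also have "real_diagonal (\<chi> j. 1 / c s j) ** real_diagonal (\<chi> j. 1 / c s j)
        = mat 1 - s^3 *\<^sub>R real_diagonal (\<chi> j. \<epsilon> s $ j / (c s j)\<^sup>2)"
    proof -
      have "1 / (c s j)\<^sup>2 = 1 - s^3 * (\<epsilon> s $ j / (c s j)\<^sup>2)" for j
      proof -
        have "1 - s^3 * (\<epsilon> s $ j / (c s j)\<^sup>2) = ((c s j)\<^sup>2 - s^3 * \<epsilon> s $ j) / (c s j)\<^sup>2"
          using c[of j] by (simp add: diff_divide_distrib)
        also have "(c s j)\<^sup>2 - s^3 * \<epsilon> s $ j = 1"
          by (simp add: c_square[OF s])
        finally show ?thesis by simp
      qed
      then have "(\<chi> j. 1 / c s j * (1 / c s j)) = 1 - s^3 *\<^sub>R (\<chi> j. \<epsilon> s $ j / (c s j)\<^sup>2)"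
        by (simp add: vec_eq_iff power2_eq_square)
      moreover have "real_diagonal 1 = (mat 1 :: complex^'n^'n)"
        by (simp add: real_diagonal_def mat_def vec_eq_iff)
      ultimately show ?thesis
        by (simp add: real_diagonal_mult real_diagonal_linear)
    qed
    also have "Y s ** (mat 1 - s^3 *\<^sub>R real_diagonal (\<chi> j. \<epsilon> s $ j / (c s j)\<^sup>2)) ** (Y s)\<^sup>\<dagger>
        = Y s ** (Y s)\<^sup>\<dagger> - s^3 *\<^sub>R (Y s ** real_diagonal (\<chi> j. \<epsilon> s $ j / (c s j)\<^sup>2) ** (Y s)\<^sup>\<dagger>)"
      by (simp add: matrix_mult_bilinear)
    also have "Y s ** (Y s)\<^sup>\<dagger> = M s ** (Q s ** (Q s)\<^sup>\<dagger>) ** (M s)\<^sup>\<dagger>"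
      by (simp add: Y_def conj_transpose_mult matrix_mul_assoc)
    also have "\<dots> = ?T + s^3 *\<^sub>R (M s ** F s ** (M s)\<^sup>\<dagger>)"
      by (simp add: QQ matrix_mult_bilinear MM[OF s])
    finally have ST: "?S - ?T = s^3 *\<^sub>R X s"
      by (simp add: X_def scaleR_diff_right)
    have "?S\<^sup>\<dagger> = ?S" "?T\<^sup>\<dagger> = ?T"
      by (simp_all add: conj_transpose_mult matrix_mul_assoc)
    from K[OF this] have "\<bar>eigenvalue_vector ?S $ j - L s $ j\<bar> \<le> s^3 * norm (X s) * K" for j
      using s by (simp add: ST eigenvalue_vector_unitary_diagonal[OF U L(1)[OF s]])
    moreover have "W s $ j - (m - l) $ j = (eigenvalue_vector ?S $ j - L s $ j) / s\<^sup>2" for j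
      using s by (simp add: W_def L_def field_simps)
    ultimately have "\<bar>W s $ j - (m - l) $ j\<bar> \<le> s^3 * norm (X s) * K / s\<^sup>2" for j
      using s by (simp add: divide_right_mono)
    then show ?case
      using s by (simp add: power2_eq_square power3_eq_cube mult.assoc)
  qed
  have "(W \<longlongrightarrow> m - l) (at_right 0)"
  proof (rule vec_tendstoI)
    fix j
    have "((\<lambda>s. s * norm (X s) * K) \<longlongrightarrow> 0 * norm X0 * K) (at_right 0)"
      by (intro tendsto_intros s0 X_lim)
    then have "((\<lambda>s. s * norm (X s) * K) \<longlongrightarrow> 0) (at_right 0)"
      by simp
    moreover have "\<forall>\<^sub>F s in at_right 0. norm (W s $ j - (m - l) $ j) \<le> s * norm (X s) * K"
      using bound by eventually_elim auto
    ultimately have "((\<lambda>s. W s $ j - (m - l) $ j) \<longlongrightarrow> 0) (at_right 0)"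
      by (rule Lim_null_comparison[rotated])
    then show "((\<lambda>s. W s $ j) \<longlongrightarrow> (m - l) $ j) (at_right 0)"
      by (rule LIM_zero_cancel)
  qed
  with unit Zs_lim show thesis
    unfolding W_def[abs_def] by (rule that)
qed

text \<open>
  Both spectra have sum \<open>CARD('n)\<close>, so the spectral change \<open>H\<close> of the Gram matrix has trace \<open>0\<close>. If two
  columns are not orthogonal, \<open>diagonal_correction\<close> applies. Otherwise the Gram matrix is \<open>1\<close>, all its
  eigenvalues are \<open>1\<close> and nothing can be transferred by conjugation; but the eigenbasis is then free,
  and the flat one gives \<open>H\<close> a zero diagonal from the start.
\<close>

lemma frame_path_exists:
  fixes Z V :: "complex^'n^('d::{finite, linorder})"
  assumes Z: "Z \<in> unit_column_matrices" and V: "V \<in> unit_column_matrices"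
  defines "l \<equiv> eigenvalue_vector (Z ** Z\<^sup>\<dagger>)" and "m \<equiv> eigenvalue_vector (V ** V\<^sup>\<dagger>)"
  obtains Zs where "\<forall>\<^sub>F s in at_right 0. Zs s \<in> unit_column_matrices" "(Zs \<longlongrightarrow> Z) (at_right 0)"
    "((\<lambda>s. (eigenvalue_vector (Zs s ** (Zs s)\<^sup>\<dagger>) - l) /\<^sub>R s\<^sup>2) \<longlongrightarrow> m - l) (at_right (0::real))"
proof -
  let ?J = "leading_indices CARD('n) :: 'd set"
  have m: "decreasing m" "\<And>j. 0 \<le> m $ j" "\<And>j. j \<notin> ?J \<Longrightarrow> m $ j = 0"
    unfolding m_def by (rule singular_value_decomposition[of V]; blast)+
  have l: "decreasing l" "\<And>j. 0 \<le> l $ j" "\<And>j. j \<notin> ?J \<Longrightarrow> l $ j = 0"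
    unfolding l_def by (rule singular_value_decomposition[of Z]; blast)+
  have sum0: "(\<Sum>j\<in>UNIV. (m - l) $ j) = 0"
    using sum_eigenvalue_vector_frame[OF Z] sum_eigenvalue_vector_frame[OF V]
    by (simp add: l_def m_def sum_subtractf)
  define G where "G = Z\<^sup>\<dagger> ** Z"
  have G: "G\<^sup>\<dagger> = G" "\<And>i. G $ i $ i = 1"
    using Z by (simp_all add: G_def conj_transpose_mult unit_column_matrices_gram)
  show thesis
  proof (cases "\<exists>a b. a \<noteq> b \<and> G $ a $ b \<noteq> 0")
    case True
    then obtain a b where ab: "a \<noteq> b" "G $ a $ b \<noteq> 0" by blast
    obtain U :: "complex^('d::{finite, linorder})^('d::{finite, linorder})" and A :: "complex^('d::{finite, linorder})^'n"
      where UA: "U\<^sup>\<dagger> ** U = mat 1" "A\<^sup>\<dagger> ** A = real_diagonal (leading_indicator CARD('n))"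
        "Z = U ** real_diagonal (\<chi> j. sqrt (l $ j)) ** A\<^sup>\<dagger>"
      unfolding l_def by (rule singular_value_decomposition[of Z])
    define H where "H = A ** real_diagonal (m - l) ** A\<^sup>\<dagger>"
    have "H\<^sup>\<dagger> = H"
      by (simp add: H_def conj_transpose_mult matrix_mul_assoc)
    moreover have "trace H = 0"
    proof -
      have "trace H = trace (real_diagonal (m - l) ** real_diagonal (leading_indicator CARD('n)))"
        by (simp add: H_def trace_unitary_diagonal UA(2))
      also have "real_diagonal (m - l) ** real_diagonal (leading_indicator CARD('n)) = real_diagonal (m - l)"
        unfolding real_diagonal_mult
        using l(3) m(3) by (intro arg_cong[of _ _ real_diagonal]) (simp add: leading_indicator_def vec_eq_iff)
      finally show ?thesis
        by (simp only: trace_real_diagonal sum0 of_real_0)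
    qed
    ultimately obtain B P where "B\<^sup>\<dagger> = - B" "P + P\<^sup>\<dagger> = B ** B" "\<And>i. (G ** B - B ** G) $ i $ i = 0"
      "\<And>i. (H + P\<^sup>\<dagger> ** G + G ** P - B ** G ** B) $ i $ i = 0"
      using diagonal_correction[OF G ab] by blast
    then show thesis
      using frame_path[OF Z UA l(1) m(1) l(2) m(2) l(3) m(3)] that unfolding G_def H_def by blast
  next
    case False
    then have "Z\<^sup>\<dagger> ** Z = mat 1"
      using G(2) by (auto simp: G_def vec_eq_iff mat_def)
    then obtain U :: "complex^('d::{finite, linorder})^('d::{finite, linorder})" and A :: "complex^('d::{finite, linorder})^'n"
      where UA: "U\<^sup>\<dagger> ** U = mat 1" "A\<^sup>\<dagger> ** A = real_diagonal (leading_indicator CARD('n))"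
        "Z = U ** real_diagonal (\<chi> j. sqrt (l $ j)) ** A\<^sup>\<dagger>"
      and flat: "\<And>i j. j \<in> ?J \<Longrightarrow> A $ i $ j * cnj (A $ i $ j) = 1 / of_nat CARD('n)"
      unfolding l_def by (rule isometry_flat_decomposition) blast
    have H_diag: "(A ** real_diagonal (m - l) ** A\<^sup>\<dagger>) $ i $ i = 0" for i
    proof -
      have "(A ** real_diagonal (m - l) ** A\<^sup>\<dagger>) $ i $ i
          = (\<Sum>j\<in>UNIV. of_real ((m - l) $ j) * (A $ i $ j * cnj (A $ i $ j)))"
        by (simp add: matrix_matrix_mult_def[of "_ ** _"] mult_real_diagonal_nth mult_ac)
      also have "\<dots> = (\<Sum>j\<in>UNIV. of_real ((m - l) $ j) * (1 / of_nat CARD('n)))"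
      proof (intro sum.cong refl)
        fix j show "of_real ((m - l) $ j) * (A $ i $ j * cnj (A $ i $ j)) = of_real ((m - l) $ j) * (1 / of_nat CARD('n))"
          using flat[of j i] l(3)[of j] m(3)[of j] by (cases "j \<in> ?J") simp_all
      qed
      also have "\<dots> = of_real (\<Sum>j\<in>UNIV. (m - l) $ j) * (1 / of_nat CARD('n))"
        by (simp only: sum_distrib_right of_real_sum)
      finally show ?thesis by (simp only: sum0) simp
    qed
    have zero: "(0 :: complex^'n^'n)\<^sup>\<dagger> = 0"
      by (simp add: vec_eq_iff)
    show thesis
    proof (rule frame_path[OF Z UA l(1) m(1) l(2) m(2) l(3) m(3), where B = 0 and P = 0])
      show "(A ** real_diagonal (m - l) ** A\<^sup>\<dagger> + 0\<^sup>\<dagger> ** (Z\<^sup>\<dagger> ** Z) + Z\<^sup>\<dagger> ** Z ** 0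
          - 0 ** (Z\<^sup>\<dagger> ** Z) ** 0) $ i $ i = 0" for i
        using H_diag[of i] by (simp add: zero)
    qed (simp_all add: zero that)
  qed
qed

text \<open>
  Along the path, \<open>w\<^sub>s = (\<lambda>(Z\<^sub>s) - \<lambda>(Z)) / s\<^sup>2\<close> tends to \<open>\<lambda>(V) - \<lambda>(Z)\<close>. Writing \<open>\<lambda>(Z\<^sub>s)\<close> as the convex
  combination \<open>(1 - s\<^sup>2) \<lambda>(Z) + s\<^sup>2 (\<lambda>(Z) + w\<^sub>s)\<close> turns local minimality into \<open>f (\<lambda>(Z)) \<le> f (\<lambda>(Z) + w\<^sub>s)\<close>,
  and the factor \<open>s\<^sup>2\<close> disappears before the limit is taken; continuity of \<open>f\<close> does the rest.
\<close>

theorem theorem2: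
  fixes f :: "real ^ ('d :: {finite, linorder}) \<Rightarrow> real"
    and Z :: "complex ^ 'n ^ ('d :: {finite, linorder})"
  assumes "convex_on UNIV f"
    and "local_minimizer_on unit_column_matrices (frame_potential f) Z"
  shows "global_minimizer_on unit_column_matrices (frame_potential f) Z"
proof -
  obtain T where Z: "Z \<in> unit_column_matrices" and T: "open T" "Z \<in> T"
    and le: "\<And>V. V \<in> unit_column_matrices \<inter> T \<Longrightarrow> frame_potential f Z \<le> frame_potential f V"
    using assms(2) by (auto simp: local_minimizer_on_def)
  have "frame_potential f Z \<le> frame_potential f V" if V: "V \<in> unit_column_matrices"
    for V :: "complex ^ 'n ^ ('d :: {finite, linorder})"
  proof -
    define l where "l = eigenvalue_vector (Z ** Z\<^sup>\<dagger>)"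
    define m where "m = eigenvalue_vector (V ** V\<^sup>\<dagger>)"
    obtain Zs where unit: "\<forall>\<^sub>F s in at_right 0. Zs s \<in> unit_column_matrices"
      and lim: "(Zs \<longlongrightarrow> Z) (at_right 0)"
      and dir: "((\<lambda>s. (eigenvalue_vector (Zs s ** (Zs s)\<^sup>\<dagger>) - l) /\<^sub>R s\<^sup>2) \<longlongrightarrow> m - l) (at_right (0::real))"
      unfolding l_def m_def by (rule frame_path_exists[OF Z V])
    define w where "w s = (eigenvalue_vector (Zs s ** (Zs s)\<^sup>\<dagger>) - l) /\<^sub>R s\<^sup>2" for s
    have "\<forall>\<^sub>F s in at_right 0. Zs s \<in> T"
      using lim T by (rule topological_tendstoD)
    moreover have "\<forall>\<^sub>F s in at_right (0::real). 0 < s \<and> s < 1"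
      by (rule eventually_at_rightI[of 0 1]) auto
    ultimately have "\<forall>\<^sub>F s in at_right 0. f l \<le> f (l + w s)"
      using unit
    proof eventually_elim
      case (elim s)
      then have s: "0 < s" "s\<^sup>2 < 1"
        by (simp_all add: power_less_one_iff)
      have "f l \<le> f (eigenvalue_vector (Zs s ** (Zs s)\<^sup>\<dagger>))"
        using le[of "Zs s"] elim by (simp add: frame_potential_def l_def)
      also have "eigenvalue_vector (Zs s ** (Zs s)\<^sup>\<dagger>) = (1 - s\<^sup>2) *\<^sub>R l + s\<^sup>2 *\<^sub>R (l + w s)"
        using s by (simp add: w_def algebra_simps)
      also have "f \<dots> \<le> (1 - s\<^sup>2) * f l + s\<^sup>2 * f (l + w s)"
        using s by (intro convex_onD[OF assms(1)]) auto
      finally have "s\<^sup>2 * f l \<le> s\<^sup>2 * f (l + w s)"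
        by (simp add: algebra_simps)
      then show ?case using s by simp
    qed
    moreover have "((\<lambda>s. f (l + w s)) \<longlongrightarrow> f (l + (m - l))) (at_right 0)"
    proof -
      have "isCont f (l + (m - l))"
        using convex_on_continuous[OF open_UNIV assms(1)] by (simp add: continuous_on_eq_continuous_at)
      moreover have "((\<lambda>s. l + w s) \<longlongrightarrow> l + (m - l)) (at_right 0)"
        unfolding w_def by (intro tendsto_intros dir)
      ultimately show ?thesis
        by (rule isCont_tendsto_compose)
    qed
    ultimately have "f l \<le> f (l + (m - l))"
      using tendsto_lowerbound trivial_limit_at_right_real by blast
    then show ?thesis
      by (simp add: frame_potential_def l_def m_def)
  qed
  with Z show ?thesis
    by (simp add: global_minimizer_on_def)
qed

end
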